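(* Let $U$ be an $\mathbb{F}_q$-subspace of $V=\mathbb{F}_{q^n}^r$ with $\dim_{\mathbb{F}_q}U=rn-n$, and let $F_U\in\mathbb{F}_{q^n}[x_0,\dots,x_{r-1}]$ be its determinantal polynomial. If $P\in L_U$ has weight $k\ge 2$, then $P$ is a singular point of the hypersurface $F_U=0$ of multiplicity exactly $1+q+\dots+q^{k-1}$ (i.e. in affine coordinates centred at $P$ the lowest-degree nonzero homogeneous component of $F_U$ has degree $1+q+\dots+q^{k-1}$).
   Context: $q$ a prime power, $n,r\ge 2$, $V=\mathbb{F}_{q^n}^r$. For an $\mathbb{F}_q$-subspace $U$, $L_U=\{\langle u\rangle_{\mathbb{F}_{q^n}}:u\in U\setminus\{0\}\}\subseteq\mathrm{PG}(r-1,q^n)$, and the weight of $P=\langle v\rangle_{\mathbb{F}_{q^n}}$ is $w_{L_U}(P)=\dim_{\mathbb{F}_q}(\langle v\rangle_{\mathbb{F}_{q^n}}\cap U)$. Determinantal polynomial: for $u=(u_0,\dots,u_{r-1})\in V$ let $\hat u=(u_0,\dots,u_{r-1},u_0^q,\dots,u_{r-1}^q,\dots,u_0^{q^{n-1}},\dots,u_{r-1}^{q^{n-1}})\in\mathbb{F}_{q^n}^{rn}$. If $\dim_{\mathbb{F}_q}U=rn-n$ with $\mathbb{F}_q$-basis $u_1,\dots,u_{rn-n}$, $F_U(x_0,\dots,x_{r-1})$ is the determinant of the $rn\times rn$ matrix whose first $rn-n$ rows are $\hat u_1,\dots,\hat u_{rn-n}$ and whose remaining $n$ rows are, for $i=0,\dots,n-1$,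 the vector having $x_0^{q^i},\dots,x_{r-1}^{q^i}$ in positions $ir,\dots,ir+r-1$ and zeros elsewhere. $F_U$ is a nonzero homogeneous polynomial of degree $1+q+\dots+q^{n-1}$, determined by $U$ up to a nonzero scalar, whose zeros in $\mathrm{PG}(r-1,q^n)$ are exactly the points of $L_U$. *)

theory Defs
  imports "HOL-Library.Poly_Mapping" "Jordan_Normal_Form.Determinant"
begin

(* Conventions.
  The field F_{q^n} is a finite field type 'a with CARD('a) = q^n.
  F_q is the subfield of F_{q^n} fixed by x \<mapsto> x^q.
  Vectors of V = F_{q^n}^r are functions nat \<Rightarrow> 'a vanishing at indices \<ge> r.
  Polynomials in x_0,...,x_{r-1} are finitely supported maps from monomials
  (exponent vectors nat \<Rightarrow>\<^sub>0 nat) to coefficients. *)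

type_synonym 'a mpoly = "(nat \<Rightarrow>\<^sub>0 nat) \<Rightarrow>\<^sub>0 'a"

definition Fq :: "nat \<Rightarrow> 'a::field set" where
  "Fq q = {x. x ^ q = x}"

definition Vspace :: "nat \<Rightarrow> (nat \<Rightarrow> 'a::zero) set" where
  "Vspace r = {v. \<forall>i\<ge>r. v i = 0}"

definition smult_vec :: "'a::times \<Rightarrow> (nat \<Rightarrow> 'a) \<Rightarrow> (nat \<Rightarrow> 'a)" where
  "smult_vec c v = (\<lambda>j. c * v j)"

definition lin_comb :: "(nat \<Rightarrow> 'a::field) \<Rightarrow> (nat \<Rightarrow> 'a) list \<Rightarrow> (nat \<Rightarrow> 'a)" where
  "lin_comb c bs = (\<lambda>j. \<Sum>i<length bs. c i * (bs ! i) j)"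

definition fq_span :: "nat \<Rightarrow> (nat \<Rightarrow> 'a::field) list \<Rightarrow> (nat \<Rightarrow> 'a) set" where
  "fq_span q bs = {lin_comb c bs | c. \<forall>i. c i \<in> Fq q}"

definition fq_indep :: "nat \<Rightarrow> (nat \<Rightarrow> 'a::field) list \<Rightarrow> bool" where
  "fq_indep q bs \<longleftrightarrow> (\<forall>c. (\<forall>i<length bs. c i \<in> Fq q) \<longrightarrow> lin_comb c bs = (\<lambda>_. 0)
                          \<longrightarrow> (\<forall>i<length bs. c i = 0))"

definition fq_basis :: "nat \<Rightarrow> (nat \<Rightarrow> 'a::field) set \<Rightarrow> (nat \<Rightarrow> 'a) list \<Rightarrow> bool" where
  "fq_basis q W bs \<longleftrightarrow> fq_indep q bs \<and> fq_span q bs = W"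

definition fq_dim :: "nat \<Rightarrow> (nat \<Rightarrow> 'a::field) set \<Rightarrow> nat \<Rightarrow> bool" where
  "fq_dim q W k \<longleftrightarrow> (\<exists>bs. length bs = k \<and> fq_basis q W bs)"

(* F_{q^n}-span of v, i.e. the projective point P = <v>, as a vector subspace. *)
definition line_of :: "(nat \<Rightarrow> 'a::field) \<Rightarrow> (nat \<Rightarrow> 'a) set" where
  "line_of v = {smult_vec c v | c. True}"

definition has_weight :: "nat \<Rightarrow> (nat \<Rightarrow> 'a::field) set \<Rightarrow> (nat \<Rightarrow> 'a) \<Rightarrow> nat \<Rightarrow> bool" where
  "has_weight q U v k \<longleftrightarrow> fq_dim q (line_of v \<inter> U) k"

definition constP :: "'a::zero \<Rightarrow> 'a mpoly" where
  "constP c = Poly_Mapping.single 0 c"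

definition Xvar :: "nat \<Rightarrow> 'a::{zero,one} mpoly" where
  "Xvar j = Poly_Mapping.single (Poly_Mapping.single j 1) 1"

(* The determinantal polynomial F_U built from an F_q-basis bs = [u_1,...,u_{rn-n}]:
  row l < rn-n is the hat vector of u_{l+1}, i.e. entry at column i*r+j is (u_{l+1})_j^(q^i);
  row rn-n+i (i<n) has x_j^(q^i) at column i*r+j and 0 elsewhere. *)
definition det_matrix :: "nat \<Rightarrow> nat \<Rightarrow> nat \<Rightarrow> (nat \<Rightarrow> 'a::field) list \<Rightarrow> 'a mpoly mat" where
  "det_matrix q n r bs = mat (r*n) (r*n) (\<lambda>(l, col).
      let i = col div r; j = col mod r in
      if l < r*n - n then constP (((bs ! l) j) ^ (q ^ i))
      else if i = l - (r*n - n) then (Xvar j) ^ (q ^ i) else 0)"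

definition detpoly :: "nat \<Rightarrow> nat \<Rightarrow> nat \<Rightarrow> (nat \<Rightarrow> 'a::field) list \<Rightarrow> 'a mpoly" where
  "detpoly q n r bs = det (det_matrix q n r bs)"

definition translate :: "nat \<Rightarrow> (nat \<Rightarrow> 'a::field) \<Rightarrow> 'a mpoly \<Rightarrow> 'a mpoly" where
  "translate r v F = (\<Sum>\<alpha>\<in>Poly_Mapping.keys F.
      constP (Poly_Mapping.lookup F \<alpha>) *
      (\<Prod>j<r. (constP (v j) + Xvar j) ^ Poly_Mapping.lookup \<alpha> j))"

definition total_deg :: "(nat \<Rightarrow>\<^sub>0 nat) \<Rightarrow> nat" where
  "total_deg \<alpha> = (\<Sum>j\<in>Poly_Mapping.keys \<alpha>. Poly_Mapping.lookup \<alpha> j)"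

definition multiplicity_at :: "nat \<Rightarrow> (nat \<Rightarrow> 'a::field) \<Rightarrow> 'a mpoly \<Rightarrow> nat" where
  "multiplicity_at r v F = Min (total_deg ` Poly_Mapping.keys (translate r v F))"

end

theory Submission
  imports Defs "HOL-Library.Function_Algebras"
begin

text \<open>
  Write \<open>\<langle>x,y\<rangle>\<close> for the standard bilinear form and \<open>Tr\<close> for the trace to \<open>F\<^sub>q\<close>, so that the product of the
  hat vectors of \<open>u\<close> and \<open>t\<close> is \<open>Tr\<langle>u,t\<rangle>\<close>. The \<open>F\<^sub>q\<close>-space \<open>T\<close> orthogonal to \<open>U\<close> has dimension \<open>n\<close>,
  and multiplying the matrix of \<open>F\<^sub>U\<close> by the hat vectors of a basis \<open>t\<^sub>0, \<dots>, t\<^bsub>n-1\<^esub>\<close> of \<open>T\<close>, together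
  with those of a trace-dual family of the basis of \<open>U\<close>, shows that \<open>F\<^sub>U(x)\<close> is, up to a nonzero
  constant, the Moore determinant of the linear forms \<open>\<langle>x,t\<^sub>m\<rangle>\<close>.

  By trace duality, \<open>v\<close> has weight \<open>k\<close> iff \<open>{t \<in> T. \<langle>v,t\<rangle> = 0}\<close> has dimension \<open>k\<close>; let \<open>t\<^sub>0, \<dots>, t\<^bsub>k-1\<^esub>\<close>
  span that space. In the Moore determinant at \<open>v + x\<close>, row \<open>i\<close> of the first \<open>k\<close> columns then has order at
  least \<open>q\<^sup>i\<close>, so by the Leibniz formula every monomial has degree at least \<open>1 + q + \<dots> + q\<^bsup>k-1\<^esup>\<close>. The
  component of that degree is the Moore determinant of \<open>\<langle>x,t\<^sub>0\<rangle>, \<dots>, \<langle>x,t\<^bsub>k-1\<^esub>\<rangle>\<close> times a power of the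
  Moore determinant of \<open>\<langle>v,t\<^sub>k\<rangle>, \<dots>, \<langle>v,t\<^bsub>n-1\<^esub>\<rangle>\<close>. Both factors are nonzero; for the first one, count the
  vectors orthogonal to some nonzero element of the span of \<open>t\<^sub>0, \<dots>, t\<^bsub>k-1\<^esub>\<close>.
\<close>


section \<open>Substitution and order of multivariate polynomials\<close>

lemma poly_mapping_add_induct [case_names zero single_plus]:
  assumes "P 0" and "\<And>a b f. P f \<Longrightarrow> P (Poly_Mapping.single a b + f)"
  shows "P (f :: 'a \<Rightarrow>\<^sub>0 'b::monoid_add)"
proof (induction f rule: Poly_Mapping.update_induct)
  case const
  show ?case by (rule assms(1))
next
  case (update f a b)
  have "Poly_Mapping.update a b f = Poly_Mapping.single a b + f"
    using update(1)
    by (intro poly_mapping_eqI) (auto simp: lookup_update lookup_add lookup_single in_keys_iff when_def)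
  then show ?case using assms(2)[OF update(3)] by simp
qed

definition monomial_value :: "(nat \<Rightarrow> 'b::comm_monoid_mult) \<Rightarrow> (nat \<Rightarrow>\<^sub>0 nat) \<Rightarrow> 'b" where
  "monomial_value f \<alpha> = (\<Prod>j\<in>Poly_Mapping.keys \<alpha>. f j ^ Poly_Mapping.lookup \<alpha> j)"

text \<open>Coefficients pass through \<open>h\<close>, so one construction covers both the
  translation to the point (\<open>h = constP\<close>) and the restriction to a line through the
  origin (\<open>h c = [:c:]\<close>).\<close>

definition subst_mpoly ::
    "('a::zero \<Rightarrow> 'b::comm_semiring_1) \<Rightarrow> (nat \<Rightarrow> 'b) \<Rightarrow> 'a mpoly \<Rightarrow> 'b" where
  "subst_mpoly h f F =
     (\<Sum>\<alpha>\<in>Poly_Mapping.keys F. h (Poly_Mapping.lookup F \<alpha>) * monomial_value f \<alpha>)"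

lemma monomial_value_superset:
  assumes "finite S" "Poly_Mapping.keys \<alpha> \<subseteq> S"
  shows "monomial_value f \<alpha> = (\<Prod>j\<in>S. f j ^ Poly_Mapping.lookup \<alpha> j)"
  unfolding monomial_value_def
  by (rule prod.mono_neutral_left) (use assms in \<open>auto simp: in_keys_iff\<close>)

lemma monomial_value_0: "monomial_value f 0 = 1"
  by (simp add: monomial_value_def)

lemma monomial_value_single: "monomial_value f (Poly_Mapping.single j e) = f j ^ e"
  by (simp add: monomial_value_def)

lemma monomial_value_add: "monomial_value f (\<alpha> + \<beta>) = monomial_value f \<alpha> * monomial_value f \<beta>"
proof -
  let ?S = "Poly_Mapping.keys \<alpha> \<union> Poly_Mapping.keys \<beta>"
  have "monomial_value f (\<alpha> + \<beta>) = (\<Prod>j\<in>?S. f j ^ Poly_Mapping.lookup (\<alpha> + \<beta>) j)"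
    by (rule monomial_value_superset) (use keys_add[of \<alpha> \<beta>] in auto)
  also have "\<dots> = (\<Prod>j\<in>?S. f j ^ Poly_Mapping.lookup \<alpha> j) * (\<Prod>j\<in>?S. f j ^ Poly_Mapping.lookup \<beta> j)"
    by (simp add: lookup_add power_add prod.distrib)
  finally show ?thesis
    by (simp add: monomial_value_superset[of ?S])
qed

lemma total_deg_superset:
  assumes "finite S" "Poly_Mapping.keys \<alpha> \<subseteq> S"
  shows "total_deg \<alpha> = (\<Sum>j\<in>S. Poly_Mapping.lookup \<alpha> j)"
  unfolding total_deg_def
  by (rule sum.mono_neutral_left) (use assms in \<open>auto simp: in_keys_iff\<close>)

lemma total_deg_add: "total_deg (\<alpha> + \<beta>) = total_deg \<alpha> + total_deg \<beta>"
proof -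
  let ?S = "Poly_Mapping.keys \<alpha> \<union> Poly_Mapping.keys \<beta>"
  have "total_deg (\<alpha> + \<beta>) = (\<Sum>j\<in>?S. Poly_Mapping.lookup (\<alpha> + \<beta>) j)"
    by (rule total_deg_superset) (use keys_add[of \<alpha> \<beta>] in auto)
  also have "\<dots> = (\<Sum>j\<in>?S. Poly_Mapping.lookup \<alpha> j) + (\<Sum>j\<in>?S. Poly_Mapping.lookup \<beta> j)"
    by (simp add: lookup_add sum.distrib)
  finally show ?thesis
    by (simp add: total_deg_superset[of ?S])
qed

lemma (in comm_ring_hom) subst_mpoly_single:
  "subst_mpoly hom f (Poly_Mapping.single \<alpha> c) = hom c * monomial_value f \<alpha>"
  by (simp add: subst_mpoly_def)

lemma (in comm_ring_hom) subst_mpoly_add: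
  "subst_mpoly hom f (F + G) = subst_mpoly hom f F + subst_mpoly hom f G"
  unfolding subst_mpoly_def
  by (rule setsum_keys_plus_distrib) (simp_all add: hom_distribs distrib_right)

text \<open>Additivity in both factors reduces the claim to two monomials, where it is
  \<open>monomial_value_add\<close>.\<close>

lemma (in comm_ring_hom) subst_mpoly_mult:
  "subst_mpoly hom f (F * G) = subst_mpoly hom f F * subst_mpoly hom f G"
proof (induction F rule: poly_mapping_add_induct)
  case zero
  show ?case by (simp add: subst_mpoly_def)
next
  case (single_plus \<alpha> a F)
  have "subst_mpoly hom f (Poly_Mapping.single \<alpha> a * G)
      = hom a * monomial_value f \<alpha> * subst_mpoly hom f G"
  proof (induction G rule: poly_mapping_add_induct)
    case zero
    show ?case by (simp add: subst_mpoly_def)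
  next
    case (single_plus \<beta> b G)
    then show ?case
      by (simp add: distrib_left mult_single subst_mpoly_add subst_mpoly_single monomial_value_add
          hom_mult mult_ac)
  qed
  with single_plus show ?case
    by (simp add: distrib_right subst_mpoly_add subst_mpoly_single)
qed

lemma (in comm_ring_hom) comm_ring_hom_subst_mpoly: "comm_ring_hom (subst_mpoly hom f)"
proof
  show "subst_mpoly hom f 0 = 0" by (simp add: subst_mpoly_def)
  show "subst_mpoly hom f 1 = 1"
    using subst_mpoly_single[of f 0 1] by (simp add: monomial_value_0)
qed (simp_all add: subst_mpoly_add subst_mpoly_mult)

lemma (in comm_ring_hom) subst_mpoly_constP: "subst_mpoly hom f (constP c) = hom c"
  by (simp add: constP_def subst_mpoly_single monomial_value_0)

lemma (in comm_ring_hom) subst_mpoly_Xvar: "subst_mpoly hom f (Xvar j) = f j"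
  by (simp add: Xvar_def subst_mpoly_single monomial_value_single)

interpretation constP: comm_ring_hom "constP :: 'a::comm_ring_1 \<Rightarrow> 'a mpoly"
  by unfold_locales (simp_all add: constP_def single_add mult_single)

interpretation const_poly: comm_ring_hom "\<lambda>c :: 'a::comm_ring_1. [:c:]"
  by unfold_locales (simp_all add: one_pCons)

text \<open>The default value 1 for \<open>j \<ge> r\<close> matches \<open>translate\<close>, whose
  product runs over \<open>j < r\<close> only.\<close>

lemma translate_eq_subst_mpoly:
  "translate r v F = subst_mpoly constP (\<lambda>j. if j < r then constP (v j) + Xvar j else 1) F"
proof -
  have "(\<Prod>j<r. (constP (v j) + Xvar j) ^ Poly_Mapping.lookup \<alpha> j)
      = monomial_value (\<lambda>j. if j < r then constP (v j) + Xvar j else 1) \<alpha>" for \<alpha>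
  proof -
    let ?f = "\<lambda>j. (if j < r then constP (v j) + Xvar j else 1) ^ Poly_Mapping.lookup \<alpha> j"
    have "(\<Prod>j<r. (constP (v j) + Xvar j) ^ Poly_Mapping.lookup \<alpha> j) = prod ?f {..<r}"
      by simp
    also have "\<dots> = prod ?f (Poly_Mapping.keys \<alpha> \<union> {..<r})"
      by (rule prod.mono_neutral_left) auto
    finally show ?thesis
      by (simp add: monomial_value_superset[of "Poly_Mapping.keys \<alpha> \<union> {..<r}"])
  qed
  then show ?thesis by (simp add: translate_def subst_mpoly_def)
qed

interpretation translate: comm_ring_hom "translate r v"
  unfolding translate_eq_subst_mpoly[abs_def] by (rule constP.comm_ring_hom_subst_mpoly)

lemma translate_constP: "translate r v (constP c) = constP c"
  by (simp add: translate_eq_subst_mpoly constP.subst_mpoly_constP)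

lemma translate_Xvar: "j < r \<Longrightarrow> translate r v (Xvar j) = constP (v j) + Xvar j"
  by (simp add: translate_eq_subst_mpoly constP.subst_mpoly_Xvar)

section \<open>Order of vanishing at the origin\<close>

definition order_ge :: "nat \<Rightarrow> 'a::zero mpoly \<Rightarrow> bool" where
  "order_ge d F \<longleftrightarrow> (\<forall>\<alpha>\<in>Poly_Mapping.keys F. d \<le> total_deg \<alpha>)"

lemma order_ge_0: "order_ge 0 F"
  by (simp add: order_ge_def)

lemma order_ge_mono: "order_ge d F \<Longrightarrow> e \<le> d \<Longrightarrow> order_ge e F"
  by (auto simp: order_ge_def)

lemma order_ge_sum:
  assumes "\<And>i. i \<in> I \<Longrightarrow> order_ge d (F i)"
  shows "order_ge d (\<Sum>i\<in>I. F i)"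
  using assms
proof (induction I rule: infinite_finite_induct)
  case (insert i I)
  then show ?case using keys_add[of "F i" "sum F I"] unfolding order_ge_def by fastforce
qed (auto simp: order_ge_def)

lemma order_ge_mult:
  assumes "order_ge d F" "order_ge e G"
  shows "order_ge (d + e) (F * G)"
  using assms keys_mult[of F G] unfolding order_ge_def by (fastforce simp: total_deg_add intro: add_mono)

lemma order_ge_prod:
  assumes "finite I" "\<And>i. i \<in> I \<Longrightarrow> order_ge (d i) (F i)"
  shows "order_ge (\<Sum>i\<in>I. d i) (\<Prod>i\<in>I. F i)"
  using assms by (induction I rule: finite_induct) (auto intro: order_ge_mult order_ge_0)

lemma order_ge_Xvar_power: "order_ge d (Xvar j ^ d :: 'a::comm_ring_1 mpoly)"
proof -
  have "order_ge 1 (Xvar j :: 'a mpoly)"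
    by (simp add: order_ge_def Xvar_def total_deg_def)
  then show ?thesis
    using order_ge_prod[of "{..<d}" "\<lambda>_. 1" "\<lambda>_. Xvar j :: 'a mpoly"] by simp
qed

text \<open>Restrict to the line of all \<open>s * y\<close>. A monomial of degree \<open>d\<close>
  becomes a constant times the \<open>d\<close>-th power of \<open>s\<close>, so the coefficient at
  \<open>m\<close> is the value at \<open>y\<close> of the component of degree \<open>m\<close>. If
  it is nonzero, a monomial of degree \<open>m\<close> occurs, and the order bound makes it
  minimal.\<close>

lemma multiplicity_at_eqI:
  assumes ge: "order_ge m (translate r v F)"
    and nz: "coeff (subst_mpoly (\<lambda>c. [:c:]) (\<lambda>j. [:0, y j:]) (translate r v F)) m \<noteq> 0"
  shows "F \<noteq> 0 \<and> multiplicity_at r v F = m"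
proof -
  let ?G = "translate r v F"
  have eval: "monomial_value (\<lambda>j. [:0, y j:]) \<alpha> = monom (monomial_value y \<alpha>) (total_deg \<alpha>)" for \<alpha>
  proof -
    have "(\<Prod>j\<in>S. monom (y j) 1 ^ e j) = monom (\<Prod>j\<in>S. y j ^ e j) (\<Sum>j\<in>S. e j)"
      if "finite S" for S and e :: "nat \<Rightarrow> nat"
      using that by induction (simp_all add: monom_power mult_monom)
    then show ?thesis
      by (simp add: monomial_value_def total_deg_def monom_altdef)
  qed
  have "coeff (subst_mpoly (\<lambda>c. [:c:]) (\<lambda>j. [:0, y j:]) ?G) m
      = (\<Sum>\<alpha>\<in>Poly_Mapping.keys ?G. Poly_Mapping.lookup ?G \<alpha> * coeff (monom (monomial_value y \<alpha>) (total_deg \<alpha>)) m)"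
    by (simp add: subst_mpoly_def eval coeff_sum)
  with nz obtain \<alpha> where \<alpha>: "\<alpha> \<in> Poly_Mapping.keys ?G" "coeff (monom (monomial_value y \<alpha>) (total_deg \<alpha>)) m \<noteq> 0"
    by (metis (no_types, lifting) mult_zero_right sum.neutral)
  from \<alpha>(2) have "total_deg \<alpha> = m"
    by (auto split: if_splits)
  with \<alpha>(1) ge have "multiplicity_at r v F = m"
    unfolding multiplicity_at_def order_ge_def by (intro Min_eqI) auto
  moreover from \<alpha>(1) have "F \<noteq> 0" by auto
  ultimately show ?thesis by blast
qed

section \<open>Lowest terms of determinants\<close>

lemma sum_lessThan_add:
  "(\<Sum>i<a + b. f i) = (\<Sum>i<a. f i) + (\<Sum>i<b. f (a + i))" for f :: "nat \<Rightarrow> 'b::comm_monoid_add"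
  by (induction b) (simp_all add: add.assoc)

text \<open>A column index of \<open>det_matrix\<close> carries the Frobenius exponent as its
  quotient by \<open>r\<close> and the coordinate as its remainder; this splits sums over columns
  accordingly.\<close>

lemma sum_div_mod:
  fixes g :: "nat \<Rightarrow> nat \<Rightarrow> 'b::comm_monoid_add"
  assumes "r > 0"
  shows "(\<Sum>c<r * n. g (c div r) (c mod r)) = (\<Sum>i<n. \<Sum>j<r. g i j)"
proof (induction n)
  case (Suc n)
  have "(\<Sum>c<r * Suc n. g (c div r) (c mod r))
      = (\<Sum>c<r * n. g (c div r) (c mod r)) + (\<Sum>j<r. g ((r * n + j) div r) ((r * n + j) mod r))"
    using sum_lessThan_add[of "\<lambda>c. g (c div r) (c mod r)" "r * n" r] by (simp add: add.commute)
  also have "(\<Sum>j<r. g ((r * n + j) div r) ((r * n + j) mod r)) = (\<Sum>j<r. g n j)"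
    using assms by (intro sum.cong) auto
  finally show ?case by (simp add: Suc.IH)
qed simp

text \<open>Outside their common part the two sets have equally many exponents, those of
  \<open>S\<close> being at least \<open>k\<close> and those of the initial segment below
  \<open>k\<close>. So the first \<open>k\<close> rows are the cheapest choice for the first
  \<open>k\<close> columns.\<close>

lemma sum_power_initial_segment_less:
  fixes q :: nat
  assumes q: "q \<ge> 2" and S: "finite S" "card S = k" "S \<noteq> {..<k}"
  shows "(\<Sum>i<k. q ^ i) < (\<Sum>i\<in>S. q ^ i)"
proof -
  let ?A = "S - {..<k}" and ?B = "{..<k} - S"
  have "card ?A + card (S \<inter> {..<k}) = card ?B + card (S \<inter> {..<k})"
    using S card_Int_Diff[of S "{..<k}"] card_Int_Diff[of "{..<k}" S]
    by (simp add: Int_commute)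
  then have card: "card ?A = card ?B" by simp
  have "?B \<noteq> {}"
  proof
    assume "?B = {}"
    then have "{..<k} \<subseteq> S" by blast
    then show False using S card_subset_eq[of S "{..<k}"] by simp
  qed
  then have "(\<Sum>i\<in>?B. q ^ i) < (\<Sum>i\<in>?B. q ^ k)"
    using q by (intro sum_strict_mono power_strict_increasing) auto
  also have "\<dots> = (\<Sum>i\<in>?A. q ^ k)" by (simp add: card)
  also have "\<dots> \<le> (\<Sum>i\<in>?A. q ^ i)"
    using q by (intro sum_mono power_increasing) auto
  finally have "(\<Sum>i\<in>?B. q ^ i) < (\<Sum>i\<in>?A. q ^ i)" .
  moreover have "(\<Sum>i<k. q ^ i) = (\<Sum>i\<in>S \<inter> {..<k}. q ^ i) + (\<Sum>i\<in>?B. q ^ i)"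
    using sum.Int_Diff[of "{..<k}" "\<lambda>i. q ^ i" S] by (simp add: Int_commute)
  moreover have "(\<Sum>i\<in>S. q ^ i) = (\<Sum>i\<in>S \<inter> {..<k}. q ^ i) + (\<Sum>i\<in>?A. q ^ i)"
    using sum.Int_Diff[of S "\<lambda>i. q ^ i" "{..<k}"] S by simp
  ultimately show ?thesis by simp
qed

lemma card_permutes_preimage:
  assumes "p permutes {0..<n}" "k \<le> n"
  shows "card {i \<in> {0..<n}. p i < k} = k"
proof -
  have "bij_betw p {i \<in> {0..<n}. p i < k} {..<k}"
    unfolding bij_betw_def
  proof
    show "inj_on p {i \<in> {0..<n}. p i < k}"
      using permutes_inj[OF assms(1)] by (simp add: inj_on_def)
    have "x \<in> p ` {i \<in> {0..<n}. p i < k}" if "x < k" for x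
    proof -
      have "x \<in> p ` {0..<n}" using permutes_image[OF assms(1)] that assms(2) by auto
      then show ?thesis using that by auto
    qed
    then show "p ` {i \<in> {0..<n}. p i < k} = {..<k}" by auto
  qed
  then show ?thesis using bij_betw_same_card by fastforce
qed

text \<open>A Leibniz term meets the first \<open>k\<close> columns in exactly \<open>k\<close>
  rows, and each such row \<open>i\<close> contributes order \<open>q ^ i\<close>; the total is
  least for the first \<open>k\<close> rows.\<close>

lemma order_ge_det:
  fixes N :: "'a::comm_ring_1 mpoly mat"
  assumes q: "q \<ge> 2" and N: "N \<in> carrier_mat n n" and "k \<le> n"
    and ord: "\<And>i m. i < n \<Longrightarrow> m < k \<Longrightarrow> order_ge (q ^ i) (N $$ (i, m))"
  shows "order_ge (\<Sum>i<k. q ^ i) (det N)"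
  unfolding det_def'[OF N]
proof (rule order_ge_sum)
  fix p assume "p \<in> {p. p permutes {0..<n}}"
  then have p: "p permutes {0..<n}" by simp
  let ?S = "{i \<in> {0..<n}. p i < k}"
  have "order_ge (\<Sum>i = 0..<n. if p i < k then q ^ i else 0) (\<Prod>i = 0..<n. N $$ (i, p i))"
    by (rule order_ge_prod) (auto simp: order_ge_0 ord)
  moreover have "(\<Sum>i<k. q ^ i) \<le> (\<Sum>i\<in>?S. q ^ i)"
    using sum_power_initial_segment_less[OF q, of ?S k] card_permutes_preimage[OF p \<open>k \<le> n\<close>]
    by (cases "?S = {..<k}") auto
  moreover have "(\<Sum>i\<in>?S. q ^ i) = (\<Sum>i = 0..<n. if p i < k then q ^ i else 0)"
    by (rule sum.inter_filter) simp
  ultimately have "order_ge (\<Sum>i<k. q ^ i) (\<Prod>i = 0..<n. N $$ (i, p i))"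
    by (simp add: order_ge_mono)
  then show "order_ge (\<Sum>i<k. q ^ i) (signof p * (\<Prod>i = 0..<n. N $$ (i, p i)))"
    using order_ge_mult[OF order_ge_0] by fastforce
qed

text \<open>The first \<open>k\<close> columns consist of pure monomials. By
  \<open>sum_power_initial_segment_less\<close> a Leibniz term reaches the exponent in question only
  if it matches these columns with the first \<open>k\<close> rows, that is, if it respects the
  block structure; such terms add up to the product of two block determinants.\<close>

lemma coeff_det_lowest:
  fixes a b :: "nat \<Rightarrow> nat \<Rightarrow> 'a::idom"
  assumes q: "q \<ge> 2" and "k \<le> n"
    and a: "\<And>i m. i < n \<Longrightarrow> m < k \<Longrightarrow> a i m = 0"
  shows "coeff (det (mat n n (\<lambda>(i, m). [:a i m:] + monom (b i m) (q ^ i)))) (\<Sum>i<k. q ^ i)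
    = det (mat k k (\<lambda>(i, m). b i m)) * det (mat (n - k) (n - k) (\<lambda>(i, m). a (k + i) (k + m)))"
proof -
  define E where "E i m = [:a i m:] + monom (b i m) (q ^ i)" for i m
  \<comment> \<open>The block diagonal matrix whose determinant is the wanted coefficient, compared
    with the original one Leibniz term at a time.\<close>
  define L where "L i m = (if m < k then (if i < k then b i m else 0) else (if i < k then 0 else a i m))" for i m
  have perm: "coeff (\<Prod>i = 0..<n. E i (p i)) (\<Sum>i<k. q ^ i) = (\<Prod>i = 0..<n. L i (p i))"
    if p: "p permutes {0..<n}" for p
  proof -
    let ?S = "{i \<in> {0..<n}. p i < k}"
    let ?R = "\<Prod>i\<in>{0..<n} - ?S. E i (p i)"
    have card: "card ?S = k" by (rule card_permutes_preimage[OF p \<open>k \<le> n\<close>])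
    have "(\<Prod>i = 0..<n. E i (p i)) = ?R * (\<Prod>i\<in>?S. E i (p i))"
      by (rule prod.subset_diff) auto
    also have "(\<Prod>i\<in>?S. E i (p i)) = (\<Prod>i\<in>?S. monom (b i (p i)) (q ^ i))"
      by (rule prod.cong) (auto simp: E_def a)
    also have "\<dots> = monom (\<Prod>i\<in>?S. b i (p i)) (\<Sum>i\<in>?S. q ^ i)"
    proof -
      have "(\<Prod>i\<in>S. monom (b i (p i)) (q ^ i)) = monom (\<Prod>i\<in>S. b i (p i)) (\<Sum>i\<in>S. q ^ i)"
        if "finite S" for S
        using that by induction (simp_all add: mult_monom)
      then show ?thesis by simp
    qed
    finally have prod: "(\<Prod>i = 0..<n. E i (p i)) = monom (\<Prod>i\<in>?S. b i (p i)) (\<Sum>i\<in>?S. q ^ i) * ?R"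
      by (simp add: mult.commute)
    show ?thesis
    proof (cases "?S = {..<k}")
      case True
      then have iff: "p i < k \<longleftrightarrow> i < k" if "i < n" for i
        using that by auto
      \<comment> \<open>The first \<open>k\<close> columns already supply the whole degree, so the
        remaining entries enter through their constant terms only.\<close>
      have "coeff (E i (p i)) 0 = a i (p i)" for i
        using q by (simp add: E_def)
      then have "coeff ?R 0 = (\<Prod>i\<in>{0..<n} - ?S. a i (p i))"
        by (simp add: poly_0_coeff_0[symmetric] poly_prod)
      then have "coeff (\<Prod>i = 0..<n. E i (p i)) (\<Sum>i<k. q ^ i)
          = (\<Prod>i\<in>?S. b i (p i)) * (\<Prod>i\<in>{0..<n} - ?S. a i (p i))"
        unfolding prod coeff_monom_mult arg_cong[OF True, of "sum ((^) q)"] by simp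
      also have "\<dots> = (\<Prod>i\<in>?S. L i (p i)) * (\<Prod>i\<in>{0..<n} - ?S. L i (p i))"
        by (intro arg_cong2[where f = "(*)"] prod.cong) (auto simp: L_def iff)
      also have "\<dots> = (\<Prod>i = 0..<n. L i (p i))"
        by (subst mult.commute, rule prod.subset_diff[symmetric]) auto
      finally show ?thesis .
    next
      case False
      \<comment> \<open>Some row below \<open>k\<close> is matched with a column outside the first
        \<open>k\<close>, where \<open>L\<close> is zero; on the other side the monomial factor
        alone exceeds the degree. Both sides vanish.\<close>
      have "\<not> {..<k} \<subseteq> ?S"
        using False card card_subset_eq[of ?S "{..<k}"] by auto
      then obtain i where "i < k" "i \<notin> ?S" by auto
      then have "i \<in> {0..<n}" "L i (p i) = 0" using \<open>k \<le> n\<close> by (auto simp: L_def)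
      then have "(\<Prod>i = 0..<n. L i (p i)) = 0" by (intro prod_zero) auto
      moreover have "(\<Sum>i<k. q ^ i) < (\<Sum>i\<in>?S. q ^ i)"
        using sum_power_initial_segment_less[OF q _ card False] by simp
      ultimately show ?thesis unfolding prod by (simp add: coeff_monom_mult)
    qed
  qed
  have sign: "coeff (signof p * P) d = signof p * coeff P d" for p and P :: "'a poly" and d
    by (simp add: sign_def)
  have "coeff (det (mat n n (\<lambda>(i, m). E i m))) (\<Sum>i<k. q ^ i) = det (mat n n (\<lambda>(i, m). L i m))"
    using perm by (subst (1 2) det_def'[of _ n]) (auto simp: coeff_sum sign permutes_in_image intro!: sum.cong prod.cong)
  also have "mat n n (\<lambda>(i, m). L i m)
      = four_block_mat (mat k k (\<lambda>(i, m). b i m)) (0\<^sub>m k (n - k)) (0\<^sub>m (n - k) k)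
          (mat (n - k) (n - k) (\<lambda>(i, m). a (k + i) (k + m)))"
    by (rule eq_matI) (use \<open>k \<le> n\<close> in \<open>auto simp: L_def four_block_mat_def\<close>)
  also have "det \<dots> = det (mat k k (\<lambda>(i, m). b i m)) * det (mat (n - k) (n - k) (\<lambda>(i, m). a (k + i) (k + m)))"
    by (rule det_four_block_mat_upper_right_zero) auto
  finally show ?thesis by (simp add: E_def)
qed

section \<open>Finite fields and the trace form\<close>

definition add_subgroup :: "'g::ab_group_add set \<Rightarrow> bool" where
  "add_subgroup G \<longleftrightarrow> 0 \<in> G \<and> (\<forall>x\<in>G. \<forall>y\<in>G. x - y \<in> G)"

lemma add_subgroup_add: "add_subgroup G \<Longrightarrow> x \<in> G \<Longrightarrow> y \<in> G \<Longrightarrow> x + y \<in> G"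
  unfolding add_subgroup_def by (metis diff_0 diff_minus_eq_add)

text \<open>Every nonempty fibre is a translate of the kernel. All dimension arguments below are
  carried out as such counts.\<close>

lemma card_eq_card_kernel_times_card_image:
  fixes f :: "'g::ab_group_add \<Rightarrow> 'h::ab_group_add"
  assumes "finite G" and G: "add_subgroup G"
    and add: "\<And>x y. x \<in> G \<Longrightarrow> y \<in> G \<Longrightarrow> f (x + y) = f x + f y"
  shows "card G = card {x \<in> G. f x = 0} * card (f ` G)"
proof -
  have diff: "f (x - y) = f x - f y" if "x \<in> G" "y \<in> G" for x y
    using add[of "x - y" y] that G by (auto simp: add_subgroup_def)
  have fibre: "card {x \<in> G. f x = f x0} = card {x \<in> G. f x = 0}" if "x0 \<in> G" for x0
    by (rule bij_betw_same_card[of "\<lambda>x. x - x0"], rule bij_betw_byWitness[where f' = "\<lambda>x. x + x0"])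
      (use that G in \<open>auto simp: diff add add_subgroup_add add_subgroup_def\<close>)
  have "card G = (\<Sum>z\<in>f ` G. card {x \<in> G. f x = z})"
    using sum.image_gen[OF \<open>finite G\<close>, of "\<lambda>_. 1 :: nat" f] by simp
  also have "\<dots> = (\<Sum>z\<in>f ` G. card {x \<in> G. f x = 0})"
    using fibre by (intro sum.cong) auto
  finally show ?thesis by simp
qed

locale fq_field =
  fixes q n :: nat and ty :: "'a::{finite,field} itself"
  assumes q_prime_power: "\<exists>p e. prime p \<and> e \<ge> 1 \<and> q = p ^ e"
    and n_pos: "n \<ge> 1"
    and card_field: "card (UNIV :: 'a set) = q ^ n"
begin

lemma q_ge_2: "q \<ge> 2"
proof -
  obtain p e where "prime p" "e \<ge> 1" "q = p ^ e" using q_prime_power by blast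
  then have "p ^ 1 \<le> q" using power_increasing[of 1 e p] prime_gt_0_nat[of p] by simp
  then show ?thesis using prime_ge_2_nat[OF \<open>prime p\<close>] by simp
qed

section \<open>Characteristic and Frobenius map\<close>

lemma prime_CHAR: "prime CHAR('a)"
  using finite_imp_CHAR_pos[where ?'a = 'a] prime_CHAR_semidom[where ?'a = 'a] by simp

lemma q_eq_CHAR_power: "\<exists>e. q = CHAR('a) ^ e"
proof -
  obtain p e where p: "prime p" "q = p ^ e" using q_prime_power by blast
  have "CHAR('a) dvd p ^ (e * n)"
  proof -
    \<comment> \<open>Adding 1 permutes the field, so comparing the two sums shows that the order of
      the field is zero in it.\<close>
    have "(\<Sum>x\<in>UNIV. x + 1 :: 'a) = \<Sum>UNIV"
      by (rule sum.reindex_bij_witness[of _ "\<lambda>x. x - 1" "\<lambda>x. x + 1"]) auto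
    then have "of_nat (card (UNIV :: 'a set)) = (0 :: 'a)"
      by (simp add: sum.distrib)
    then show ?thesis
      by (simp add: card_field p power_mult of_nat_eq_0_iff_char_dvd del: of_nat_power)
  qed
  then have "CHAR('a) = p"
    using prime_CHAR p(1) by (meson prime_dvd_power primes_dvd_imp_eq)
  with p show ?thesis by blast
qed

lemma CHAR_mpoly: "CHAR('a mpoly) = CHAR('a)"
proof (rule CHAR_eqI)
  show "of_nat CHAR('a) = (0 :: 'a mpoly)"
    by (simp flip: single_of_nat)
next
  fix m assume "of_nat m = (0 :: 'a mpoly)"
  then have "Poly_Mapping.lookup (Poly_Mapping.single 0 (of_nat m :: 'a) :: 'a mpoly) 0 = 0"
    by simp
  then show "CHAR('a) dvd m"
    by (simp add: of_nat_eq_0_iff_char_dvd del: single_of_nat)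
qed

lemma frobenius_sum: "(\<Sum>x\<in>A. f x :: 'a) ^ (q ^ i) = (\<Sum>x\<in>A. f x ^ (q ^ i))"
proof -
  obtain e where "q = CHAR('a) ^ e" using q_eq_CHAR_power by blast
  then show ?thesis
    by (intro freshmans_dream_sum'[OF prime_CHAR, of _ "e * i"]) (simp add: power_mult)
qed

lemma frobenius_add: "(x + y :: 'a) ^ (q ^ i) = x ^ (q ^ i) + y ^ (q ^ i)"
proof -
  obtain e where "q = CHAR('a) ^ e" using q_eq_CHAR_power by blast
  then show ?thesis
    by (intro freshmans_dream'[OF prime_CHAR, of _ "e * i"]) (simp add: power_mult)
qed

lemma frobenius_add_mpoly: "(x + y :: 'a mpoly) ^ (q ^ i) = x ^ (q ^ i) + y ^ (q ^ i)"
proof -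
  obtain e where "q = CHAR('a) ^ e" using q_eq_CHAR_power by blast
  then show ?thesis
    using prime_CHAR
    by (intro freshmans_dream'[of _ "e * i"]) (simp_all add: power_mult CHAR_mpoly)
qed

text \<open>Multiplication by \<open>x \<noteq> 0\<close> permutes the nonzero elements, so their
  product can be cancelled.\<close>

lemma power_card_field: "(x :: 'a) ^ (q ^ n) = x"
proof (cases "x = 0")
  case False
  let ?N = "card (UNIV - {0 :: 'a})"
  have "(\<Prod>y\<in>UNIV - {0}. x * y) = \<Prod>(UNIV - {0})"
    by (rule prod.reindex_bij_witness[of _ "\<lambda>y. y / x" "\<lambda>y. x * y"]) (use False in auto)
  then have "x ^ ?N = 1"
    by (simp add: prod.distrib)
  moreover have "q ^ n = Suc ?N"
    unfolding card_field[symmetric] by (rule card.remove) simp_all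
  ultimately show ?thesis by simp
next
  case True
  then show ?thesis using q_ge_2 by simp
qed

lemma Fq_0: "0 \<in> (Fq q :: 'a set)" and Fq_1: "1 \<in> (Fq q :: 'a set)"
  using q_ge_2 by (auto simp: Fq_def)

lemma Fq_add: "x \<in> Fq q \<Longrightarrow> y \<in> Fq q \<Longrightarrow> x + y \<in> (Fq q :: 'a set)"
  using frobenius_add[of x y 1] by (simp add: Fq_def)

lemma Fq_mult: "x \<in> Fq q \<Longrightarrow> y \<in> Fq q \<Longrightarrow> x * y \<in> (Fq q :: 'a set)"
  by (simp add: Fq_def power_mult_distrib)

lemma Fq_divide: "x \<in> Fq q \<Longrightarrow> y \<in> Fq q \<Longrightarrow> x / y \<in> (Fq q :: 'a set)"
  by (simp add: Fq_def power_divide)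

lemma Fq_uminus: "x \<in> Fq q \<Longrightarrow> - x \<in> (Fq q :: 'a set)"
proof -
  assume "x \<in> Fq q"
  \<comment> \<open>Additivity of the Frobenius map treats odd and even \<open>q\<close>
    alike.\<close>
  moreover have "(x + - x) ^ q = x ^ q + (- x) ^ q"
    using frobenius_add[of x "- x" 1] by simp
  ultimately show ?thesis
    using q_ge_2 by (simp add: Fq_def eq_neg_iff_add_eq_0 add.commute power_0_left)
qed

lemma Fq_diff: "x \<in> Fq q \<Longrightarrow> y \<in> Fq q \<Longrightarrow> x - y \<in> (Fq q :: 'a set)"
  using Fq_add[of x "- y"] Fq_uminus[of y] by simp

lemma Fq_power_q: "x \<in> (Fq q :: 'a set) \<Longrightarrow> x ^ (q ^ i) = x"
  by (induction i) (simp_all add: Fq_def power_mult)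

section \<open>The trace and the size of its kernel\<close>

definition trace :: "'a \<Rightarrow> 'a" where
  "trace x = (\<Sum>i<n. x ^ (q ^ i))"

lemma trace_0: "trace 0 = 0"
  using q_ge_2 by (auto simp: trace_def power_0_left)

lemma trace_add: "trace (x + y) = trace x + trace y"
  by (simp add: trace_def frobenius_add sum.distrib)

lemma trace_mult_Fq: "c \<in> Fq q \<Longrightarrow> trace (c * x) = c * trace x"
  by (simp add: trace_def power_mult_distrib Fq_power_q sum_distrib_left)

text \<open>Raising to the power \<open>q\<close> shifts the summands cyclically, the last one
  returning to \<open>x\<close> by \<open>power_card_field\<close>.\<close>

lemma trace_in_Fq: "trace x \<in> Fq q"
proof -
  obtain m where n: "n = Suc m" using n_pos by (cases n) auto
  have shift: "trace x = x + (\<Sum>i<m. x ^ (q ^ Suc i))"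
    unfolding trace_def unfolding n sum.lessThan_Suc_shift by simp
  have "trace x ^ q = (\<Sum>i<n. x ^ (q ^ Suc i))"
    using frobenius_sum[of "\<lambda>i. x ^ (q ^ i)" "{..<n}" 1]
    by (simp add: trace_def mult.commute flip: power_mult)
  also have "\<dots> = (\<Sum>i<m. x ^ (q ^ Suc i)) + x"
    using power_card_field[of x] by (simp add: n)
  also have "\<dots> = trace x"
    by (simp only: shift add.commute)
  finally show ?thesis by (simp add: Fq_def)
qed


text \<open>The sum is the value of a polynomial of degree at most \<open>q ^ (m - 1)\<close>. The
  exponents \<open>q ^ i\<close> are distinct, so no coefficients cancel and it is nonzero.\<close>

lemma card_roots_linearised:
  assumes w: "\<exists>i<m. w i \<noteq> (0 :: 'a)"
  shows "card {x. (\<Sum>i<m. w i * x ^ (q ^ i)) = 0} \<le> q ^ (m - 1)"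
proof -
  obtain i0 where i0: "i0 < m" "w i0 \<noteq> 0" using w by blast
  define P where "P = (\<Sum>i<m. monom (w i) (q ^ i))"
  have "coeff P (q ^ i0) = (\<Sum>i<m. if i = i0 then w i else 0)"
    using q_ge_2 by (auto simp: P_def coeff_sum intro!: sum.cong)
  then have "P \<noteq> 0" using i0 by auto
  have "degree P \<le> q ^ (m - 1)"
    unfolding P_def
    by (rule degree_sum_le) (use q_ge_2 in \<open>auto intro!: order.trans[OF degree_monom_le] power_increasing\<close>)
  moreover have "card {x. poly P x = 0} \<le> degree P"
    using \<open>P \<noteq> 0\<close> by (rule card_poly_roots_bound)
  moreover have "poly P x = (\<Sum>i<m. w i * x ^ (q ^ i))" for x
    by (simp add: P_def poly_sum poly_monom)
  ultimately show ?thesis by simp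
qed

lemma card_trace_kernel: "card {x. trace x = 0} \<le> q ^ (n - 1)"
proof -
  have "\<exists>i<n. (1 :: 'a) \<noteq> 0" using n_pos by (intro exI[of _ 0]) auto
  from card_roots_linearised[OF this] show ?thesis by (simp add: trace_def)
qed

text \<open>At most \<open>q\<close> elements, being roots of a polynomial of degree
  \<open>q\<close>. At least \<open>q\<close>, because the trace maps the field into
  \<open>Fq q\<close> with a kernel of at most \<open>q ^ (n - 1)\<close> elements.\<close>

lemma card_Fq: "card (Fq q :: 'a set) = q"
proof (rule antisym)
  \<comment> \<open>The linearised polynomial with coefficients -1 and 1 takes the value
    \<open>x ^ q - x\<close>.\<close>
  have "card {x. (\<Sum>i<2. (if i = 0 then - 1 else 1) * x ^ (q ^ i)) = (0 :: 'a)} \<le> q ^ (2 - 1)"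
    by (rule card_roots_linearised) auto
  also have "{x. (\<Sum>i<2. (if i = 0 then - 1 else 1) * x ^ (q ^ i)) = (0 :: 'a)} = Fq q"
    by (auto simp: Fq_def numeral_2_eq_2)
  finally show "card (Fq q :: 'a set) \<le> q" by simp
  have "q ^ n = card {x \<in> UNIV. trace x = 0} * card (range trace)"
    unfolding card_field[symmetric]
    by (rule card_eq_card_kernel_times_card_image) (auto simp: add_subgroup_def trace_add)
  also have "\<dots> \<le> q ^ (n - 1) * card (Fq q :: 'a set)"
    using card_trace_kernel trace_in_Fq by (intro mult_mono card_mono) auto
  finally show "q \<le> card (Fq q :: 'a set)"
    using q_ge_2 n_pos by (cases n) auto
qed

text \<open>For \<open>x \<noteq> 0\<close> the multiples of \<open>x\<close> fill the field, and
  the trace would vanish on more elements than its kernel can hold.\<close>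

lemma trace_nondegenerate:
  assumes "\<And>c. trace (c * x) = 0"
  shows "x = 0"
proof (rule ccontr)
  assume "x \<noteq> 0"
  then have "trace y = 0" for y using assms[of "y / x"] by simp
  then have "q ^ n \<le> q ^ (n - 1)" using card_trace_kernel card_field by simp
  then show False using q_ge_2 n_pos by (simp add: power_le_imp_le_exp)
qed

text \<open>Count the pairs with \<open>b x y = 0\<close> in both orders: a functional that is not zero vanishes on
  exactly one \<open>q\<close>-th of its domain.\<close>

lemma card_kernels_bilinear:
  fixes G :: "'g::ab_group_add set" and H :: "'h::ab_group_add set" and b :: "'g \<Rightarrow> 'h \<Rightarrow> 'a"
  assumes fin: "finite G" "finite H" and sub: "add_subgroup G" "add_subgroup H"
    and Fq: "\<And>x y. x \<in> G \<Longrightarrow> y \<in> H \<Longrightarrow> b x y \<in> Fq q"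
    and addl: "\<And>x x' y. x \<in> G \<Longrightarrow> x' \<in> G \<Longrightarrow> y \<in> H \<Longrightarrow> b (x + x') y = b x y + b x' y"
    and addr: "\<And>x y y'. x \<in> G \<Longrightarrow> y \<in> H \<Longrightarrow> y' \<in> H \<Longrightarrow> b x (y + y') = b x y + b x y'"
    and scalel: "\<And>c x y. c \<in> Fq q \<Longrightarrow> x \<in> G \<Longrightarrow> y \<in> H \<Longrightarrow> \<exists>x'\<in>G. b x' y = c * b x y"
    and scaler: "\<And>c x y. c \<in> Fq q \<Longrightarrow> x \<in> G \<Longrightarrow> y \<in> H \<Longrightarrow> \<exists>y'\<in>H. b x y' = c * b x y"
  shows "card {x \<in> G. \<forall>y\<in>H. b x y = 0} * card H = card {y \<in> H. \<forall>x\<in>G. b x y = 0} * card G"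
proof -
  \<comment> \<open>The count from one side, multiplied by \<open>q\<close> to avoid division: an
    \<open>x\<close> in the left kernel is paired with all of \<open>H\<close>, any other
    \<open>x\<close> with one \<open>q\<close>-th of it. Being stated for arbitrary sets and maps,
    it also applies with the roles of \<open>G\<close> and \<open>H\<close> exchanged.\<close>
  have half: "q * (\<Sum>x\<in>G. card {y \<in> H. b x y = 0}) + card {x \<in> G. \<forall>y\<in>H. b x y = 0} * card H
      = card G * card H + q * (card {x \<in> G. \<forall>y\<in>H. b x y = 0} * card H)"
    if fin: "finite G" "finite H" and sub: "add_subgroup H"
    and Fq: "\<And>x y. x \<in> G \<Longrightarrow> y \<in> H \<Longrightarrow> b x y \<in> Fq q"
    and addr: "\<And>x y y'. x \<in> G \<Longrightarrow> y \<in> H \<Longrightarrow> y' \<in> H \<Longrightarrow> b x (y + y') = b x y + b x y'"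
    and scaler: "\<And>c x y. c \<in> Fq q \<Longrightarrow> x \<in> G \<Longrightarrow> y \<in> H \<Longrightarrow> \<exists>y'\<in>H. b x y' = c * b x y"
    for G :: "'x set" and H :: "'y::ab_group_add set" and b :: "'x \<Rightarrow> 'y \<Rightarrow> 'a"
  proof -
    define G0 where "G0 = {x \<in> G. \<forall>y\<in>H. b x y = 0}"
    have "G0 \<subseteq> G" by (auto simp: G0_def)
    then have "finite G0" using fin finite_subset by blast
    have in_G0: "{y \<in> H. b x y = 0} = H" if "x \<in> G0" for x
      using that by (auto simp: G0_def)
    have not_G0: "q * card {y \<in> H. b x y = 0} = card H" if "x \<in> G - G0" for x
    proof -
      from that obtain y where y: "x \<in> G" "y \<in> H" "b x y \<noteq> 0" by (auto simp: G0_def)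
      \<comment> \<open>Scaling a nonzero value reaches all of \<open>Fq q\<close>, so the kernel of
        \<open>b x\<close> has index exactly \<open>q\<close>.\<close>
      have "c \<in> b x ` H" if "c \<in> Fq q" for c
        using scaler[of "c / b x y" x y] y that Fq by (force simp: Fq_divide)
      then have "b x ` H = Fq q" using Fq y by auto
      then show ?thesis
        using card_eq_card_kernel_times_card_image[of H "b x"] fin sub addr y by (simp add: card_Fq)
    qed
    have "(\<Sum>x\<in>G. card {y \<in> H. b x y = 0})
        = (\<Sum>x\<in>G - G0. card {y \<in> H. b x y = 0}) + (\<Sum>x\<in>G0. card {y \<in> H. b x y = 0})"
      using fin \<open>G0 \<subseteq> G\<close> by (intro sum.subset_diff) auto
    then have "q * (\<Sum>x\<in>G. card {y \<in> H. b x y = 0})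
        = (\<Sum>x\<in>G - G0. q * card {y \<in> H. b x y = 0}) + q * (\<Sum>x\<in>G0. card {y \<in> H. b x y = 0})"
      by (simp add: distrib_left sum_distrib_left)
    also have "\<dots> = card (G - G0) * card H + q * (card G0 * card H)"
      by (simp add: not_G0 in_G0)
    finally have "q * (\<Sum>x\<in>G. card {y \<in> H. b x y = 0}) + card G0 * card H
        = (card (G - G0) + card G0) * card H + q * (card G0 * card H)"
      by (simp add: distrib_right)
    moreover have "card (G - G0) + card G0 = card G"
      using \<open>finite G0\<close> \<open>G0 \<subseteq> G\<close> fin by (simp add: card_Diff_subset card_mono)
    ultimately show ?thesis by (simp add: G0_def)
  qed
  have "(\<Sum>x\<in>G. card {y \<in> H. b x y = 0}) = (\<Sum>x\<in>G. \<Sum>y\<in>H. if b x y = 0 then 1 else 0)"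
    using fin by (simp add: sum.inter_filter[symmetric])
  also have "\<dots> = (\<Sum>y\<in>H. \<Sum>x\<in>G. if b x y = 0 then 1 else 0)"
    by (rule sum.swap)
  also have "\<dots> = (\<Sum>y\<in>H. card {x \<in> G. b x y = 0})"
    using fin by (simp add: sum.inter_filter[symmetric])
  finally have swap: "(\<Sum>x\<in>G. card {y \<in> H. b x y = 0}) = (\<Sum>y\<in>H. card {x \<in> G. b x y = 0})" .
  \<comment> \<open>The two kernel terms satisfy the same linear equation, in which they have the
    coefficient \<open>q - 1 \<noteq> 0\<close> after collecting.\<close>
  have cancel: "a = c" if "q * X + a = N + q * a" "q * X + c = N + q * c" for X N a c :: nat
  proof -
    have "(int q - 1) * int a = (int q - 1) * int c"
      using that by (simp add: left_diff_distrib flip: of_nat_mult)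
    then show ?thesis using q_ge_2 by simp
  qed
  show ?thesis
  proof (rule cancel)
    show "q * (\<Sum>x\<in>G. card {y \<in> H. b x y = 0}) + card {x \<in> G. \<forall>y\<in>H. b x y = 0} * card H
      = card G * card H + q * (card {x \<in> G. \<forall>y\<in>H. b x y = 0} * card H)"
      by (rule half) (use assms in auto)
    show "q * (\<Sum>x\<in>G. card {y \<in> H. b x y = 0}) + card {y \<in> H. \<forall>x\<in>G. b x y = 0} * card G
      = card G * card H + q * (card {y \<in> H. \<forall>x\<in>G. b x y = 0} * card G)"
      unfolding swap mult.commute[of "card G" "card H"]
      by (rule half) (use assms in auto)
  qed
qed

end

section \<open>Vectors over the subfield\<close>

definition dot :: "nat \<Rightarrow> (nat \<Rightarrow> 'a::comm_semiring_0) \<Rightarrow> (nat \<Rightarrow> 'a) \<Rightarrow> 'a" where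
  "dot r x y = (\<Sum>j<r. x j * y j)"

lemma dot_commute: "dot r x y = dot r y x"
  by (simp add: dot_def mult.commute)

lemma dot_add_left: "dot r (x + y) z = dot r x z + dot r y z"
  by (simp add: dot_def sum.distrib distrib_right)

lemma dot_add_right: "dot r z (x + y) = dot r z x + dot r z y"
  by (simp add: dot_def sum.distrib distrib_left)

lemma dot_smult_left: "dot r (smult_vec c x) y = c * dot r x y"
  by (simp add: dot_def smult_vec_def sum_distrib_left mult.assoc)

lemma dot_smult_right: "dot r x (smult_vec c y) = c * dot r x y"
  by (simp add: dot_def smult_vec_def sum_distrib_left mult.left_commute)

lemma dot_diff_right: "dot r z (x - y) = dot r z x - dot r z (y :: nat \<Rightarrow> 'a::comm_ring)"
  by (simp add: dot_def sum_subtractf right_diff_distrib)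

lemma dot_zero_left: "dot r 0 x = 0" and dot_zero_right: "dot r x 0 = 0"
  by (simp_all add: dot_def)

lemma dot_unit_vec:
  assumes "j < r"
  shows "dot r x (\<lambda>i. if i = j then c else 0) = x j * c"
proof -
  have "dot r x (\<lambda>i. if i = j then c else 0) = (\<Sum>i<r. if i = j then x j * c else 0)"
    unfolding dot_def by (rule sum.cong) auto
  then show ?thesis using assms by simp
qed

lemma dot_lin_comb: "dot r x (lin_comb c bs) = (\<Sum>i<length bs. c i * dot r x (bs ! i))"
  unfolding dot_def lin_comb_def sum_distrib_left
  by (subst sum.swap) (simp add: mult.left_commute)

lemma lin_comb_append:
  "lin_comb c (bs @ cs) = lin_comb c bs + lin_comb (\<lambda>i. c (length bs + i)) cs"
proof
  fix j
  have "lin_comb c (bs @ cs) j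
      = (\<Sum>i<length bs. c i * ((bs @ cs) ! i) j)
        + (\<Sum>i<length cs. c (length bs + i) * ((bs @ cs) ! (length bs + i)) j)"
    by (simp add: lin_comb_def sum_lessThan_add)
  then show "lin_comb c (bs @ cs) j = (lin_comb c bs + lin_comb (\<lambda>i. c (length bs + i)) cs) j"
    by (simp add: lin_comb_def nth_append)
qed

lemma lin_comb_singleton: "lin_comb c [w] = smult_vec (c 0) w"
  by (simp add: lin_comb_def smult_vec_def)

lemma lin_comb_cong: "(\<And>i. i < length bs \<Longrightarrow> c i = d i) \<Longrightarrow> lin_comb c bs = lin_comb d bs"
  by (simp add: lin_comb_def)

lemma finite_Vspace_restricted: "finite {f \<in> Vspace r. \<forall>i<r. f i \<in> S}"
  and card_Vspace_restricted:
    "card {f \<in> Vspace r. \<forall>i<r. f i \<in> S} = card S ^ r"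
  if "finite S" "0 \<in> S" for S :: "'a::zero set"
proof -
  have bij: "bij_betw (\<lambda>f. restrict f {..<r}) {f \<in> Vspace r. \<forall>i<r. f i \<in> S} (PiE {..<r} (\<lambda>_. S))"
    by (rule bij_betw_byWitness[where f' = "\<lambda>f i. if i < r then f i else 0"])
      (auto simp: Vspace_def PiE_def extensional_def fun_eq_iff)
  show "finite {f \<in> Vspace r. \<forall>i<r. f i \<in> S}"
    using bij_betw_finite[OF bij] that by (simp add: finite_PiE)
  show "card {f \<in> Vspace r. \<forall>i<r. f i \<in> S} = card S ^ r"
    using bij_betw_same_card[OF bij] by (simp add: card_PiE)
qed

lemma finite_Vspace: "finite (Vspace r :: (nat \<Rightarrow> 'a::{finite,zero}) set)"
  using finite_Vspace_restricted[of "UNIV :: 'a set" r] by simp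

lemma card_Vspace: "card (Vspace r :: (nat \<Rightarrow> 'a::{finite,zero}) set) = card (UNIV :: 'a set) ^ r"
  using card_Vspace_restricted[of "UNIV :: 'a set" r] by simp

lemma add_subgroup_Vspace: "add_subgroup (Vspace r :: (nat \<Rightarrow> 'a::ab_group_add) set)"
  by (auto simp: add_subgroup_def Vspace_def)

lemma smult_vec_Vspace: "v \<in> Vspace r \<Longrightarrow> smult_vec c v \<in> Vspace r" for c :: "'a::mult_zero"
  by (auto simp: Vspace_def smult_vec_def)

lemma fq_indepD:
  assumes "fq_indep q bs" and "\<And>i. i < length bs \<Longrightarrow> c i \<in> Fq q" and "lin_comb c bs = (\<lambda>_. 0)"
    and "i < length bs"
  shows "c i = 0"
  using assms unfolding fq_indep_def by simp

context fq_field
begin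

section \<open>Subspaces, spans and independent lists over the subfield\<close>

definition fq_subspace :: "(nat \<Rightarrow> 'a) set \<Rightarrow> bool" where
  "fq_subspace W \<longleftrightarrow> add_subgroup W \<and> (\<forall>c\<in>Fq q. \<forall>w\<in>W. smult_vec c w \<in> W)"

lemma fq_subspace_lin_comb:
  assumes "fq_subspace W" "set bs \<subseteq> W" "\<And>i. i < length bs \<Longrightarrow> c i \<in> Fq q"
  shows "lin_comb c bs \<in> W"
  using assms(2,3)
proof (induction bs rule: rev_induct)
  case Nil
  then show ?case
    using assms(1) by (simp add: lin_comb_def fq_subspace_def add_subgroup_def zero_fun_def)
next
  case (snoc w bs)
  have "lin_comb c bs \<in> W"
    by (rule snoc.IH) (use snoc.prems in auto)
  moreover have "smult_vec (c (length bs)) w \<in> W"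
    using assms(1) snoc.prems by (auto simp: fq_subspace_def)
  ultimately have "lin_comb c bs + smult_vec (c (length bs)) w \<in> W"
    using assms(1) unfolding fq_subspace_def by (blast intro: add_subgroup_add)
  then show ?case
    by (simp add: lin_comb_append lin_comb_singleton plus_fun_def)
qed

lemma fq_span_subset: "fq_subspace W \<Longrightarrow> set bs \<subseteq> W \<Longrightarrow> fq_span q bs \<subseteq> W"
  unfolding fq_span_def using fq_subspace_lin_comb by blast

lemma fq_subspace_span: "fq_subspace (fq_span q bs :: (nat \<Rightarrow> 'a) set)"
  unfolding fq_subspace_def add_subgroup_def
proof (intro conjI ballI)
  show "0 \<in> (fq_span q bs :: (nat \<Rightarrow> 'a) set)"
    unfolding fq_span_def
    by (rule CollectI, rule exI[of _ "\<lambda>_. 0"]) (auto simp: lin_comb_def zero_fun_def Fq_0)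
next
  fix x y :: "nat \<Rightarrow> 'a" assume "x \<in> fq_span q bs" "y \<in> fq_span q bs"
  then obtain c d where "x = lin_comb c bs" "\<forall>i. c i \<in> Fq q" "y = lin_comb d bs" "\<forall>i. d i \<in> Fq q"
    unfolding fq_span_def by blast
  then show "x - y \<in> fq_span q bs"
    unfolding fq_span_def
    by (intro CollectI exI[of _ "\<lambda>i. c i - d i"])
      (auto simp: lin_comb_def sum_subtractf left_diff_distrib Fq_diff)
next
  fix a :: 'a and x :: "nat \<Rightarrow> 'a" assume "a \<in> Fq q" "x \<in> fq_span q bs"
  then obtain c where "x = lin_comb c bs" "\<forall>i. c i \<in> Fq q"
    unfolding fq_span_def by blast
  then show "smult_vec a x \<in> fq_span q bs"
    unfolding fq_span_def using \<open>a \<in> Fq q\<close>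
    by (intro CollectI exI[of _ "\<lambda>i. a * c i"])
      (auto simp: lin_comb_def smult_vec_def sum_distrib_left mult.assoc Fq_mult)
qed

lemma fq_span_superset: "set bs \<subseteq> (fq_span q bs :: (nat \<Rightarrow> 'a) set)"
proof
  fix b assume "b \<in> set bs"
  then obtain i where i: "i < length bs" "b = bs ! i" by (metis in_set_conv_nth)
  have "lin_comb (\<lambda>l. if l = i then 1 else 0) bs = b"
  proof
    fix j
    have "lin_comb (\<lambda>l. if l = i then 1 else 0) bs j = (\<Sum>l<length bs. if l = i then b j else 0)"
      unfolding lin_comb_def by (rule sum.cong) (auto simp: i)
    then show "lin_comb (\<lambda>l. if l = i then 1 else 0) bs j = b j" using i by simp
  qed
  then show "b \<in> fq_span q bs"
    unfolding fq_span_def by (intro CollectI exI[of _ "\<lambda>l. if l = i then 1 else 0"]) (auto simp: Fq_0 Fq_1)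
qed

text \<open>Independence makes the coefficients unique once they are restricted to the indices of
  the list, which is why they are taken from \<open>PiE\<close>.\<close>

lemma card_fq_span:
  assumes "fq_indep q (bs :: (nat \<Rightarrow> 'a) list)"
  shows "card (fq_span q bs) = q ^ length bs"
proof -
  let ?C = "PiE {..<length bs} (\<lambda>_. Fq q :: 'a set)"
  have "fq_span q bs = (\<lambda>c. lin_comb c bs) ` ?C"
  proof (intro equalityI subsetI)
    fix x assume "x \<in> fq_span q bs"
    then obtain c where c: "x = lin_comb c bs" "\<forall>i. c i \<in> Fq q" unfolding fq_span_def by blast
    then have "x = lin_comb (restrict c {..<length bs}) bs"
      by (auto intro: lin_comb_cong)
    then show "x \<in> (\<lambda>c. lin_comb c bs) ` ?C"
      by (intro image_eqI[of _ _ "restrict c {..<length bs}"]) (use c in auto)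
  next
    fix x assume "x \<in> (\<lambda>c. lin_comb c bs) ` ?C"
    then obtain c where c: "x = lin_comb c bs" "c \<in> ?C" by blast
    then show "x \<in> fq_span q bs"
      using fq_subspace_lin_comb[OF fq_subspace_span fq_span_superset] by (auto simp: PiE_iff)
  qed
  moreover have "inj_on (\<lambda>c. lin_comb c bs) ?C"
  proof (rule inj_onI)
    fix c d assume c: "c \<in> ?C" and d: "d \<in> ?C" and eq: "lin_comb c bs = lin_comb d bs"
    have "lin_comb (\<lambda>i. c i - d i) bs = (\<lambda>_. 0)"
    proof
      fix j
      show "lin_comb (\<lambda>i. c i - d i) bs j = 0"
        using fun_cong[OF eq, of j] by (simp add: lin_comb_def left_diff_distrib sum_subtractf)
    qed
    then have "\<forall>i<length bs. c i - d i = 0"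
      using c d by (intro allI impI fq_indepD[OF assms, of "\<lambda>i. c i - d i"]) (auto simp: PiE_iff Fq_diff)
    then show "c = d" using c d by (intro PiE_ext[of c _ _ d]) auto
  qed
  ultimately show ?thesis by (simp add: card_image card_PiE card_Fq)
qed

lemma fq_indep_snoc:
  assumes bs: "fq_indep q (bs :: (nat \<Rightarrow> 'a) list)" and w: "w \<notin> fq_span q bs"
  shows "fq_indep q (bs @ [w])"
  unfolding fq_indep_def
proof (intro allI impI)
  fix c i
  assume c: "\<forall>i<length (bs @ [w]). c i \<in> Fq q" and eq: "lin_comb c (bs @ [w]) = (\<lambda>_. 0)"
    and i: "i < length (bs @ [w])"
  let ?a = "c (length bs)"
  have *: "lin_comb c bs j + ?a * w j = 0" for j
    using fun_cong[OF eq, of j] by (simp add: lin_comb_append lin_comb_singleton smult_vec_def)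
  have "?a = 0"
  proof (rule ccontr)
    assume a: "?a \<noteq> 0"
    have "w j = - lin_comb c bs j / ?a" for j
      using *[of j] a by (simp add: field_simps eq_neg_iff_add_eq_0)
    then have "w = lin_comb (\<lambda>i. - c i / ?a) bs"
      by (auto simp: lin_comb_def fun_eq_iff sum_divide_distrib sum_negf)
    moreover have "lin_comb (\<lambda>i. - c i / ?a) bs \<in> fq_span q bs"
      using c by (intro fq_subspace_lin_comb[OF fq_subspace_span fq_span_superset] Fq_divide Fq_uminus) auto
    ultimately show False using w by simp
  qed
  moreover have "\<forall>i<length bs. c i = 0"
    using c * \<open>?a = 0\<close> by (intro allI impI fq_indepD[OF bs, of c]) (auto simp: fun_eq_iff)
  ultimately show "c i = 0" using i by (auto simp: less_Suc_eq)
qed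

text \<open>Dimension is measured by cardinality: a list shorter than \<open>d\<close> spans fewer
  than \<open>q ^ d\<close> vectors, so some vector of \<open>W\<close> is outside its span and can
  be appended; at length \<open>d\<close> the span fills \<open>W\<close>.\<close>

lemma fq_indep_extend:
  assumes W: "fq_subspace W" "finite W" "card W = q ^ d"
    and bs: "fq_indep q bs" "set bs \<subseteq> W"
  shows "\<exists>cs. length (bs @ cs) = d \<and> fq_indep q (bs @ cs) \<and> fq_span q (bs @ cs) = W"
  using bs
proof (induction "d - length bs" arbitrary: bs)
  case (0 bs)
  have "q ^ length bs \<le> q ^ d"
    using card_mono[OF W(2) fq_span_subset[OF W(1) 0(3)]] by (simp add: card_fq_span 0 W)
  then have "length bs = d" using 0 q_ge_2 power_le_imp_le_exp[of q "length bs" d] by auto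
  moreover have "fq_span q bs = W"
    using card_subset_eq[OF W(2) fq_span_subset[OF W(1) 0(3)]] by (simp add: card_fq_span 0 W calculation)
  ultimately show ?case using 0 by (intro exI[of _ "[]"]) simp
next
  case (Suc m bs)
  have "q ^ length bs < q ^ d"
    using Suc(2) q_ge_2 by (intro power_strict_increasing) auto
  then have "fq_span q bs \<noteq> W" using W Suc by (metis card_fq_span less_irrefl)
  then obtain w where w: "w \<in> W" "w \<notin> fq_span q bs" using fq_span_subset[OF W(1) Suc(4)] by blast
  have "\<exists>cs. length ((bs @ [w]) @ cs) = d \<and> fq_indep q ((bs @ [w]) @ cs) \<and> fq_span q ((bs @ [w]) @ cs) = W"
    by (rule Suc.hyps(1)) (use Suc w in \<open>auto intro: fq_indep_snoc\<close>)
  then show ?case by (metis append.assoc)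
qed

lemma fq_indep_Nil: "fq_indep q []"
  by (simp add: fq_indep_def)

text \<open>A kernel vector would be the coefficient vector of a nonzero linearised polynomial of
  degree at most \<open>q ^ (m - 1)\<close> vanishing at all \<open>a j\<close>, hence on their span
  over \<open>Fq q\<close>, which has \<open>q ^ m\<close> elements.\<close>

lemma moore_det_nonzero:
  assumes indep: "\<And>c. (\<And>j. j < m \<Longrightarrow> c j \<in> Fq q) \<Longrightarrow> (\<Sum>j<m. c j * a j) = (0 :: 'a) \<Longrightarrow> \<forall>j<m. c j = 0"
  shows "det (mat m m (\<lambda>(i, j). a j ^ (q ^ i))) \<noteq> 0"
proof
  \<comment> \<open>Transposed, so that the kernel vector is indexed by the Frobenius
    exponents.\<close>
  let ?M = "mat m m (\<lambda>(j, i). a j ^ (q ^ i))"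
  assume "det (mat m m (\<lambda>(i, j). a j ^ (q ^ i))) = 0"
  moreover have "transpose_mat (mat m m (\<lambda>(i, j). a j ^ (q ^ i))) = ?M" by auto
  ultimately have "det ?M = 0"
    by (metis det_transpose mat_carrier)
  then obtain w where w: "w \<in> carrier_vec m" "w \<noteq> 0\<^sub>v m" "?M *\<^sub>v w = 0\<^sub>v m"
    using det_0_iff_vec_prod_zero[of ?M m] by auto
  have zero: "(\<Sum>i<m. w $ i * a j ^ (q ^ i)) = 0" if "j < m" for j
  proof -
    have "(?M *\<^sub>v w) $ j = 0" using w that by simp
    then show ?thesis
      using that w(1) by (simp add: scalar_prod_def lessThan_atLeast0 mult.commute)
  qed
  have ex: "\<exists>i<m. w $ i \<noteq> 0" using w by (metis carrier_vecD eq_vecI index_zero_vec)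
  \<comment> \<open>Field elements are viewed as constant functions to make
    \<open>card_fq_span\<close> applicable; evaluation at 0 recovers them.\<close>
  define bs where "bs = map (\<lambda>j (_::nat). a j) [0..<m]"
  have lc: "lin_comb c bs = (\<lambda>_. \<Sum>j<m. c j * a j)" for c
    by (simp add: lin_comb_def bs_def)
  have len: "length bs = m" by (simp add: bs_def)
  have "fq_indep q bs"
    unfolding fq_indep_def lc len using indep by (metis (no_types, lifting))
  then have "q ^ m = card (fq_span q bs)" by (simp add: card_fq_span len)
  also have "\<dots> = card ((\<lambda>x. x 0) ` fq_span q bs)"
    by (rule card_image[symmetric]) (auto simp: inj_on_def fq_span_def lc)
  also have "\<dots> \<le> card {x. (\<Sum>i<m. w $ i * x ^ (q ^ i)) = 0}"
  proof (rule card_mono)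
    show "(\<lambda>x. x 0) ` fq_span q bs \<subseteq> {x. (\<Sum>i<m. w $ i * x ^ (q ^ i)) = 0}"
    proof
      fix x assume "x \<in> (\<lambda>x. x 0) ` fq_span q bs"
      then obtain c where c: "\<forall>j. c j \<in> Fq q" "x = (\<Sum>j<m. c j * a j)"
        by (auto simp: fq_span_def lc)
      have "(\<Sum>i<m. w $ i * x ^ (q ^ i)) = (\<Sum>i<m. \<Sum>j<m. c j * (w $ i * a j ^ (q ^ i)))"
        using c by (simp add: frobenius_sum power_mult_distrib Fq_power_q sum_distrib_left mult.left_commute)
      also have "\<dots> = (\<Sum>j<m. c j * (\<Sum>i<m. w $ i * a j ^ (q ^ i)))"
        by (subst sum.swap) (simp add: sum_distrib_left)
      finally show "x \<in> {x. (\<Sum>i<m. w $ i * x ^ (q ^ i)) = 0}" by (simp add: zero)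
    qed
  qed simp
  also have "\<dots> \<le> q ^ (m - 1)" by (rule card_roots_linearised[OF ex])
  finally show False using q_ge_2 ex power_strict_increasing[of "m - 1" m q] by auto
qed

text \<open>Frobenius powers of a relation between hat vectors sum up to \<open>\<Sum>\<^sub>m Tr(c y\<^sub>m) w\<^sub>m = 0\<close>, whose
  coefficients lie in \<open>F\<^sub>q\<close>.\<close>

lemma hat_vectors_indep:
  assumes ws: "fq_indep q ws" "set ws \<subseteq> Vspace r"
    and zero: "\<And>i j. i < n \<Longrightarrow> j < r \<Longrightarrow> (\<Sum>m<length ws. y m * (ws ! m) j ^ (q ^ i)) = (0 :: 'a)"
    and m: "m < length ws"
  shows "y m = 0"
proof (rule trace_nondegenerate)
  fix c
  have pow: "(\<Sum>m<length ws. y m ^ (q ^ a) * (ws ! m) j) = 0" if "a < n" "j < r" for a j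
  proof -
    \<comment> \<open>Chosen so that \<open>i + a\<close> is 0 or \<open>n\<close>, hence the two
      Frobenius powers cancel; the case \<open>a = 0\<close> is separate to keep
      \<open>i < n\<close>.\<close>
    define i where "i = (if a = 0 then 0 else n - a)"
    have "i < n" using that by (auto simp: i_def)
    have "x ^ (q ^ (i + a)) = x" for x :: 'a
      using that power_card_field by (cases "a = 0") (auto simp: i_def)
    then have x: "(x ^ (q ^ i)) ^ (q ^ a) = x" for x :: 'a
      by (simp add: power_add power_mult)
    have "0 = (\<Sum>m<length ws. y m * (ws ! m) j ^ (q ^ i)) ^ (q ^ a)"
      using zero[OF \<open>i < n\<close> that(2)] q_ge_2 by (simp add: power_0_left)
    also have "\<dots> = (\<Sum>m<length ws. y m ^ (q ^ a) * (ws ! m) j)"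
      by (simp add: frobenius_sum power_mult_distrib x)
    finally show ?thesis by simp
  qed
  have "lin_comb (\<lambda>m. trace (c * y m)) ws = (\<lambda>_. 0)"
  proof
    fix j
    show "lin_comb (\<lambda>m. trace (c * y m)) ws j = 0"
    proof (cases "j < r")
      case True
      have "lin_comb (\<lambda>m. trace (c * y m)) ws j
          = (\<Sum>m<length ws. \<Sum>a<n. c ^ (q ^ a) * (y m ^ (q ^ a) * (ws ! m) j))"
        by (simp add: lin_comb_def trace_def sum_distrib_right power_mult_distrib mult.assoc)
      also have "\<dots> = (\<Sum>a<n. c ^ (q ^ a) * (\<Sum>m<length ws. y m ^ (q ^ a) * (ws ! m) j))"
        by (subst sum.swap) (simp add: sum_distrib_left)
      also have "\<dots> = 0" using pow True by simp
      finally show ?thesis .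
    next
      case False
      have "ws ! m \<in> Vspace r" if "m < length ws" for m
        using ws(2) nth_mem[OF that] by blast
      then have "(ws ! m) j = 0" if "m < length ws" for m
        using that False by (simp add: Vspace_def)
      then show ?thesis by (simp add: lin_comb_def)
    qed
  qed
  then show "trace (c * y m) = 0"
    using m by (intro fq_indepD[OF ws(1), of "\<lambda>m. trace (c * y m)"] trace_in_Fq)
qed

section \<open>Trace duality\<close>

definition perp :: "nat \<Rightarrow> (nat \<Rightarrow> 'a) set \<Rightarrow> (nat \<Rightarrow> 'a) set" where
  "perp r W = {t \<in> Vspace r. \<forall>u\<in>W. trace (dot r u t) = 0}"

lemma trace_diff: "trace (x - y) = trace x - trace y"
  using trace_add[of "x - y" y] by simp

text \<open>Testing against the multiples of a unit vector reduces this to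
  \<open>trace_nondegenerate\<close> in each coordinate.\<close>

lemma trace_dot_nondegenerate:
  assumes "x \<in> Vspace r" and "\<And>y. y \<in> Vspace r \<Longrightarrow> trace (dot r x y) = 0"
  shows "x = 0"
proof
  fix j
  show "x j = 0 j"
  proof (cases "j < r")
    case True
    have "trace (c * x j) = 0" for c
    proof -
      have "(\<lambda>i. if i = j then c else 0) \<in> Vspace r" using True by (auto simp: Vspace_def)
      from assms(2)[OF this] show ?thesis by (simp add: dot_unit_vec[OF True] mult.commute)
    qed
    then show ?thesis by (simp add: trace_nondegenerate)
  qed (use assms(1) in \<open>simp add: Vspace_def\<close>)
qed

lemma fq_subspace_perp: "fq_subspace (perp r W)"
  using add_subgroup_Vspace[of r, where ?'a = 'a]
  by (auto simp: fq_subspace_def add_subgroup_def perp_def dot_diff_right dot_smult_right dot_zero_right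
      trace_diff trace_0 trace_mult_Fq smult_vec_Vspace simp del: minus_apply)

lemma perp_subset: "perp r W \<subseteq> Vspace r"
  by (auto simp: perp_def)

text \<open>Pair \<open>W\<close> with the whole space: the kernel on the side of \<open>W\<close>
  is trivial by nondegeneracy, the one on the other side is \<open>perp r W\<close>.\<close>

lemma card_perp:
  assumes W: "fq_subspace W" "W \<subseteq> Vspace r"
  shows "card (perp r W) * card W = q ^ (n * r)"
proof -
  have fin: "finite W" using W(2) finite_Vspace finite_subset by blast
  have "card {x \<in> W. \<forall>y\<in>Vspace r. trace (dot r x y) = 0} * card (Vspace r :: (nat \<Rightarrow> 'a) set)
      = card {y \<in> Vspace r. \<forall>x\<in>W. trace (dot r x y) = 0} * card W"
  proof (rule card_kernels_bilinear)
    fix c :: 'a and x y assume *: "c \<in> Fq q" "x \<in> W" "y \<in> (Vspace r :: (nat \<Rightarrow> 'a) set)"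
    show "\<exists>x'\<in>W. trace (dot r x' y) = c * trace (dot r x y)"
      using * W(1) by (intro bexI[of _ "smult_vec c x"]) (auto simp: dot_smult_left trace_mult_Fq fq_subspace_def)
    show "\<exists>y'\<in>Vspace r. trace (dot r x y') = c * trace (dot r x y)"
      using * by (intro bexI[of _ "smult_vec c y"]) (auto simp: dot_smult_right trace_mult_Fq smult_vec_Vspace)
  qed (use W fin in \<open>auto simp: finite_Vspace add_subgroup_Vspace fq_subspace_def trace_in_Fq
        dot_add_left dot_add_right trace_add simp del: plus_fun_apply\<close>)
  moreover have "{x \<in> W. \<forall>y\<in>Vspace r. trace (dot r x y) = 0} = {0}"
    using W trace_dot_nondegenerate[of _ r]
    by (auto simp: fq_subspace_def add_subgroup_def dot_zero_left trace_0 simp del: zero_fun_apply)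
  ultimately show ?thesis
    by (simp add: card_Vspace card_field perp_def power_mult)
qed

text \<open>One inclusion is clear, and two applications of \<open>card_perp\<close> give equal
  cardinalities.\<close>

lemma perp_perp:
  assumes W: "fq_subspace W" "W \<subseteq> Vspace r"
  shows "perp r (perp r W) = W"
proof (rule card_subset_eq[symmetric])
  show "finite (perp r (perp r W))" using finite_subset[OF perp_subset finite_Vspace] .
  show "W \<subseteq> perp r (perp r W)"
    using W(2) by (auto simp: perp_def dot_commute)
  have "card (perp r W) * card W = card (perp r (perp r W)) * card (perp r W)"
    using card_perp[OF W] card_perp[OF fq_subspace_perp perp_subset, of r W] by simp
  moreover have "card (perp r W) \<noteq> 0"
  proof
    assume "card (perp r W) = 0"
    then show False using card_perp[OF W] q_ge_2 by simp
  qed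
  ultimately show "card W = card (perp r (perp r W))" by simp
qed

text \<open>This links the weight of \<open>v\<close> to \<open>perp r W\<close>. Pair scalars
  \<open>c\<close> with vectors \<open>t\<close> by \<open>trace (c * dot r v t)\<close>: a scalar
  is in the kernel iff \<open>smult_vec c v\<close> lies in the double complement, which is
  \<open>W\<close>; a vector \<open>t\<close> is in the kernel iff
  \<open>dot r v t = 0\<close>.\<close>

lemma card_perp_inter_orthogonal:
  assumes W: "fq_subspace W" "W \<subseteq> Vspace r" and v: "v \<in> Vspace r"
  shows "card {c. smult_vec c v \<in> W} * card (perp r W) = card {t \<in> perp r W. dot r v t = 0} * q ^ n"
proof -
  let ?T = "perp r W"
  have "card {c \<in> UNIV. \<forall>t\<in>?T. trace (c * dot r v t) = 0} * card ?T
      = card {t \<in> ?T. \<forall>c\<in>UNIV. trace (c * dot r v t) = 0} * card (UNIV :: 'a set)"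
  proof (rule card_kernels_bilinear)
    fix a c :: 'a and t assume *: "a \<in> Fq q" "t \<in> ?T"
    show "\<exists>c'\<in>UNIV. trace (c' * dot r v t) = a * trace (c * dot r v t)"
      using * by (intro bexI[of _ "a * c"]) (auto simp: trace_mult_Fq mult.assoc)
    show "\<exists>t'\<in>?T. trace (c * dot r v t') = a * trace (c * dot r v t)"
      using * fq_subspace_perp[of r W]
      by (intro bexI[of _ "smult_vec a t"])
        (auto simp: dot_smult_right trace_mult_Fq fq_subspace_def mult.left_commute)
  qed (use fq_subspace_perp[of r W] finite_subset[OF perp_subset finite_Vspace, of r W] in
      \<open>auto simp: add_subgroup_def fq_subspace_def trace_in_Fq dot_add_right
        trace_add distrib_left distrib_right simp del: plus_fun_apply\<close>)
  moreover have "{c \<in> UNIV. \<forall>t\<in>?T. trace (c * dot r v t) = 0} = {c. smult_vec c v \<in> W}"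
  proof -
    have "(\<forall>t\<in>?T. trace (c * dot r v t) = 0) \<longleftrightarrow> smult_vec c v \<in> perp r ?T" for c
      using smult_vec_Vspace[OF v, of c]
      by (simp add: perp_def[of r "perp r W"] dot_smult_right dot_commute[of r v])
    then show ?thesis by (simp add: perp_perp[OF W])
  qed
  moreover have "{t \<in> ?T. \<forall>c\<in>UNIV. trace (c * dot r v t) = 0} = {t \<in> ?T. dot r v t = 0}"
    using trace_nondegenerate by (auto simp: trace_0)
  ultimately show ?thesis by (simp add: card_field)
qed

text \<open>The map \<open>\<phi>\<close> collecting the trace products with \<open>bs\<close> has
  kernel \<open>perp r (fq_span q bs)\<close>. Counting shows that its image is everything with
  coordinates in \<open>Fq q\<close>, and preimages of unit vectors form the dual family.\<close>

lemma exists_trace_dual_family: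
  assumes bs: "fq_indep q bs" "set bs \<subseteq> Vspace r"
  obtains es where "length es = length bs" "set es \<subseteq> Vspace r"
    and "\<And>l m. l < length bs \<Longrightarrow> m < length bs \<Longrightarrow>
          trace (dot r (bs ! l) (es ! m)) = (if l = m then 1 else 0)"
proof -
  let ?V = "Vspace r :: (nat \<Rightarrow> 'a) set" and ?N = "length bs"
  define \<phi> where "\<phi> w = (\<lambda>l. if l < ?N then trace (dot r (bs ! l) w) else 0)" for w
  let ?C = "{f \<in> Vspace ?N. \<forall>l<?N. f l \<in> Fq q}"
  have sub: "fq_span q bs \<subseteq> ?V"
    by (rule fq_span_subset) (use bs in \<open>auto simp: fq_subspace_def add_subgroup_Vspace smult_vec_Vspace\<close>)
  have add: "\<phi> (x + y) = \<phi> x + \<phi> y" for x y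
    by (rule ext) (simp add: \<phi>_def dot_add_right trace_add)
  have "{w \<in> ?V. \<phi> w = 0} = perp r (fq_span q bs)"
  proof (intro equalityI subsetI)
    fix w assume w: "w \<in> {w \<in> ?V. \<phi> w = 0}"
    then have z: "trace (dot r (bs ! l) w) = 0" if "l < ?N" for l
      using that by (auto simp: \<phi>_def fun_eq_iff split: if_splits)
    \<comment> \<open>Orthogonality is symmetric and \<open>perp r {w}\<close> is a subspace, so it
      passes from the list to its span.\<close>
    have "set bs \<subseteq> perp r {w}"
      using z bs(2) by (auto simp: perp_def in_set_conv_nth dot_commute[of r w])
    then have "fq_span q bs \<subseteq> perp r {w}"
      by (rule fq_span_subset[OF fq_subspace_perp])
    then show "w \<in> perp r (fq_span q bs)"
      using w by (auto simp: perp_def dot_commute[of r w])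
  next
    fix w assume "w \<in> perp r (fq_span q bs)"
    then show "w \<in> {w \<in> ?V. \<phi> w = 0}"
      using subsetD[OF fq_span_superset nth_mem, of _ bs] by (auto simp: perp_def \<phi>_def fun_eq_iff)
  qed
  then have "card ?V = card (perp r (fq_span q bs)) * card (\<phi> ` ?V)"
    using card_eq_card_kernel_times_card_image[OF finite_Vspace add_subgroup_Vspace, where f = \<phi>] add
    by simp
  moreover have "card (perp r (fq_span q bs)) * q ^ ?N = card ?V"
    using card_perp[OF fq_subspace_span sub]
    by (simp add: card_fq_span bs card_Vspace card_field power_mult)
  moreover have "card ?V \<noteq> 0" using q_ge_2 by (simp add: card_Vspace card_field)
  ultimately have "card (\<phi> ` ?V) = q ^ ?N" by (metis mult_cancel_left mult_0)
  moreover have "\<phi> ` ?V \<subseteq> ?C"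
    by (auto simp: \<phi>_def Vspace_def trace_in_Fq)
  ultimately have surj: "\<phi> ` ?V = ?C"
    using finite_Vspace_restricted[of "Fq q :: 'a set" ?N] card_Vspace_restricted[of "Fq q :: 'a set" ?N]
    by (intro card_subset_eq) (auto simp: Fq_0 card_Fq)
  have "\<exists>e\<in>?V. \<phi> e = (\<lambda>l. if l = m then 1 else 0)" if "m < ?N" for m
  proof -
    have "(\<lambda>l. if l = m then 1 else 0 :: 'a) \<in> ?C" using that by (auto simp: Vspace_def Fq_0 Fq_1)
    then show ?thesis unfolding surj[symmetric] by auto
  qed
  then obtain e where e: "\<And>m. m < ?N \<Longrightarrow> e m \<in> ?V \<and> \<phi> (e m) = (\<lambda>l. if l = m then 1 else 0)"
    by metis
  show ?thesis
  proof (rule that[of "map e [0..<?N]"])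
    fix l m assume "l < ?N" "m < ?N"
    then show "trace (dot r (bs ! l) (map e [0..<?N] ! m)) = (if l = m then 1 else 0)"
      using e[of m] by (auto simp: \<phi>_def fun_eq_iff split: if_splits)
  qed (use e in auto)
qed

text \<open>Each nonzero \<open>t\<close> in \<open>H\<close> excludes a hyperplane, one part in
  \<open>q ^ n\<close> of the space; fewer than \<open>q ^ n\<close> hyperplanes cannot cover
  it.\<close>

lemma exists_vector_not_orthogonal:
  assumes "r \<ge> 1" and H: "H \<subseteq> Vspace r" "0 \<in> H" "card H \<le> q ^ n"
  obtains y :: "nat \<Rightarrow> 'a" where "\<And>t. t \<in> H \<Longrightarrow> t \<noteq> 0 \<Longrightarrow> dot r y t \<noteq> 0"
proof -
  let ?V = "Vspace r :: (nat \<Rightarrow> 'a) set"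
  have fin: "finite H" using H finite_Vspace finite_subset by blast
  define K where "K = q ^ (n * (r - 1))"
  have K: "K * q ^ n = card ?V"
    using \<open>r \<ge> 1\<close> unfolding K_def card_Vspace card_field
    by (cases r) (auto simp: power_mult[symmetric] power_add[symmetric] algebra_simps)
  have hyperplane: "card {y \<in> ?V. dot r t y = 0} = K" if "t \<in> H - {0}" for t
  proof -
    from that H obtain j where j: "t j \<noteq> 0" by (auto simp: fun_eq_iff)
    then have "j < r" using that H by (auto simp: Vspace_def not_le[symmetric])
    have "c \<in> dot r t ` ?V" for c
      by (rule image_eqI[of _ _ "\<lambda>i. if i = j then c / t j else 0"])
        (use j \<open>j < r\<close> in \<open>auto simp: dot_unit_vec Vspace_def\<close>)
    then have "dot r t ` ?V = UNIV" by blast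
    then have "card ?V = card {y \<in> ?V. dot r t y = 0} * q ^ n"
      using card_eq_card_kernel_times_card_image[of ?V "dot r t"]
      by (simp add: finite_Vspace add_subgroup_Vspace dot_add_right card_field del: plus_fun_apply)
    with K have "K * q ^ n = card {y \<in> ?V. dot r t y = 0} * q ^ n" by simp
    then show ?thesis using q_ge_2 by simp
  qed
  let ?B = "\<Union>t\<in>H - {0}. {y \<in> ?V. dot r t y = 0}"
  have "card ?B \<le> (\<Sum>t\<in>H - {0}. card {y \<in> ?V. dot r t y = 0})"
    using fin by (intro card_UN_le) auto
  also have "\<dots> = card (H - {0}) * K" by (simp add: hyperplane)
  also have "\<dots> < q ^ n * K"
    using card_Diff1_less[OF fin H(2)] H(3) q_ge_2 by (intro mult_strict_right_mono) (auto simp: K_def)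
  also have "\<dots> = card ?V" using K by (simp add: mult.commute)
  finally have "?B \<noteq> ?V" by auto
  then obtain y where "y \<in> ?V" "y \<notin> ?B" by blast
  then show ?thesis using that[of y] by (auto simp: dot_commute[of r y])
qed

section \<open>The determinantal polynomial as a Moore determinant\<close>

lemma trace_sum_Fq:
  assumes "\<And>i. i \<in> I \<Longrightarrow> c i \<in> Fq q"
  shows "trace (\<Sum>i\<in>I. c i * x i) = (\<Sum>i\<in>I. c i * trace (x i))"
  using assms by (induction I rule: infinite_finite_induct) (simp_all add: trace_0 trace_add trace_mult_Fq)

text \<open>Pairing a relation with \<open>bs ! l\<close> isolates the coefficient of
  \<open>es ! l\<close>; what remains is a relation between the \<open>ts\<close>.\<close>

lemma fq_indep_append_dual:
  assumes len: "length es = length bs" and ts: "fq_indep q ts"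
    and dual: "\<And>l m. l < length bs \<Longrightarrow> m < length bs \<Longrightarrow>
          trace (dot r (bs ! l) (es ! m)) = (if l = m then 1 else 0)"
    and orth: "\<And>l m. l < length bs \<Longrightarrow> m < length ts \<Longrightarrow> trace (dot r (bs ! l) (ts ! m)) = 0"
  shows "fq_indep q (es @ ts)"
  unfolding fq_indep_def
proof (intro allI impI)
  fix c i
  assume c: "\<forall>i<length (es @ ts). c i \<in> Fq q" and eq: "lin_comb c (es @ ts) = (\<lambda>_. 0)"
    and i: "i < length (es @ ts)"
  let ?d = "\<lambda>i. c (length es + i)"
  have zero: "c l = 0" if l: "l < length bs" for l
  proof -
    have "0 = trace (dot r (bs ! l) (lin_comb c es + lin_comb ?d ts))"
      using eq by (simp only: lin_comb_append zero_fun_def[symmetric] dot_zero_right trace_0)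
    also have "\<dots> = (\<Sum>m<length es. c m * trace (dot r (bs ! l) (es ! m)))
        + (\<Sum>m<length ts. ?d m * trace (dot r (bs ! l) (ts ! m)))"
      unfolding dot_add_right dot_lin_comb trace_add
      by (intro arg_cong2[where f = "(+)"] trace_sum_Fq) (use c in auto)
    also have "(\<Sum>m<length ts. ?d m * trace (dot r (bs ! l) (ts ! m))) = 0"
      using l orth by simp
    also have "(\<Sum>m<length es. c m * trace (dot r (bs ! l) (es ! m))) = (\<Sum>m<length es. if m = l then c m else 0)"
      by (rule sum.cong) (use l len dual in auto)
    finally show ?thesis using l len by simp
  qed
  then have "lin_comb c es = (\<lambda>_. 0)"
    using len by (simp add: lin_comb_def)
  then have "lin_comb ?d ts = (\<lambda>_. 0)"
    using eq by (simp add: lin_comb_append fun_eq_iff)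
  then have "?d m = 0" if "m < length ts" for m
    using c that by (intro fq_indepD[OF ts, of ?d]) auto
  then have "c i = 0" if "length es \<le> i"
    using i that by (metis add_diff_inverse_nat add_less_cancel_left length_append not_le)
  then show "c i = 0"
    using zero len by (cases "i < length es") auto
qed

text \<open>The hat vectors are the columns, so that the product of a constant row of
  \<open>det_matrix\<close> with a column is a trace.\<close>

definition hat_matrix :: "nat \<Rightarrow> (nat \<Rightarrow> 'a) list \<Rightarrow> 'a mat" where
  "hat_matrix r ws = mat (r * n) (r * n) (\<lambda>(c, m). (ws ! m) (c mod r) ^ (q ^ (c div r)))"

text \<open>The entries are \<open>\<langle>v + x, t\<^sub>m\<rangle>\<close> raised to the power \<open>q\<^sup>i\<close>, expanded by the Frobenius map.\<close>

definition moore_translate :: "nat \<Rightarrow> (nat \<Rightarrow> 'a) \<Rightarrow> (nat \<Rightarrow> 'a) list \<Rightarrow> 'a mpoly mat" where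
  "moore_translate r v ts = mat n n (\<lambda>(i, m). constP (dot r v (ts ! m) ^ (q ^ i))
      + (\<Sum>j<r. Xvar j ^ (q ^ i) * constP ((ts ! m) j ^ (q ^ i))))"

text \<open>A kernel vector is a linear relation between the hat vectors, which
  \<open>hat_vectors_indep\<close> excludes.\<close>

lemma det_hat_matrix_nonzero:
  assumes "fq_indep q ws" "set ws \<subseteq> Vspace r" "length ws = r * n"
  shows "det (hat_matrix r ws) \<noteq> 0"
proof
  have carr: "hat_matrix r ws \<in> carrier_mat (r * n) (r * n)" by (simp add: hat_matrix_def)
  assume "det (hat_matrix r ws) = 0"
  then obtain y where y: "y \<in> carrier_vec (r * n)" "y \<noteq> 0\<^sub>v (r * n)" "hat_matrix r ws *\<^sub>v y = 0\<^sub>v (r * n)"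
    using det_0_iff_vec_prod_zero[OF carr] by auto
  have "(\<Sum>m<length ws. y $ m * (ws ! m) j ^ (q ^ i)) = 0" if "i < n" "j < r" for i j
  proof -
    \<comment> \<open>Row \<open>r * i + j\<close> of the matrix holds the powers with exponent
      \<open>q ^ i\<close> of coordinate \<open>j\<close>.\<close>
    have "r * i + j < r * Suc i" using that by simp
    also have "\<dots> \<le> r * n" using that by (intro mult_le_mono2) simp
    finally have c: "r * i + j < r * n" .
    have "(hat_matrix r ws *\<^sub>v y) $ (r * i + j) = 0" using y(3) c by simp
    then show ?thesis
      using c y(1) that assms(3)
      by (simp add: hat_matrix_def scalar_prod_def lessThan_atLeast0 mult.commute)
  qed
  then have "y $ m = 0" if "m < r * n" for m
    using hat_vectors_indep[OF assms(1,2), of "\<lambda>m. y $ m" m] that assms(3) by simp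
  then have "y = 0\<^sub>v (r * n)" using y(1) by (intro eq_vecI) auto
  then show False using y(2) by simp
qed

text \<open>Duality and orthogonality turn the upper rows of the product into an identity block
  followed by a zero block, and the lower right block is the Moore matrix. Translation is a ring
  homomorphism, so it may be applied to the entries before taking the determinant.\<close>

lemma translate_det_matrix_mult_hat_matrix:
  assumes r: "r \<ge> 1"
    and len: "length bs = r * n - n" "length es = r * n - n" "length ts = n"
    and dual: "\<And>l m. l < length bs \<Longrightarrow> m < length bs \<Longrightarrow>
          trace (dot r (bs ! l) (es ! m)) = (if l = m then 1 else 0)"
    and orth: "\<And>l m. l < length bs \<Longrightarrow> m < n \<Longrightarrow> trace (dot r (bs ! l) (ts ! m)) = 0"
  shows "translate r v (detpoly q n r bs) * constP (det (hat_matrix r (es @ ts)))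
    = det (moore_translate r v ts)"
proof -
  let ?N = "r * n - n" and ?M = "map_mat (translate r v) (det_matrix q n r bs)"
  let ?K = "map_mat constP (hat_matrix r (es @ ts)) :: 'a mpoly mat"
  define Z where "Z = mat n ?N (\<lambda>(i, m). (?M * ?K) $$ (?N + i, m))"
  have rn: "r * n = ?N + n" using r by simp
  have M: "?M \<in> carrier_mat (r * n) (r * n)" by (simp add: det_matrix_def)
  have K: "?K \<in> carrier_mat (r * n) (r * n)" by (simp add: hat_matrix_def)
  have entry: "(?M * ?K) $$ (l, m) = (\<Sum>c<r * n. ?M $$ (l, c) * ?K $$ (c, m))"
    if "l < r * n" "m < r * n" for l m
    using that M K by (simp add: scalar_prod_def lessThan_atLeast0)
  have upper: "(?M * ?K) $$ (l, m) = constP (trace (dot r (bs ! l) ((es @ ts) ! m)))"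
    if l: "l < ?N" and m: "m < r * n" for l m
  proof -
    have l': "l < r * n" using l by simp
    have "(?M * ?K) $$ (l, m) = (\<Sum>c<r * n. (\<lambda>i j. constP (((bs ! l) j * ((es @ ts) ! m) j) ^ (q ^ i))) (c div r) (c mod r))"
      unfolding entry[OF l' m]
      by (rule sum.cong)
        (use l l' m in \<open>auto simp: det_matrix_def hat_matrix_def Let_def translate_constP constP.hom_mult power_mult_distrib\<close>)
    also have "\<dots> = (\<Sum>i<n. \<Sum>j<r. constP (((bs ! l) j * ((es @ ts) ! m) j) ^ (q ^ i)))"
      using r by (intro sum_div_mod) simp
    also have "\<dots> = constP (trace (dot r (bs ! l) ((es @ ts) ! m)))"
      by (simp add: trace_def dot_def frobenius_sum constP.hom_sum)
    finally show ?thesis .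
  qed
  \<comment> \<open>Each of the last \<open>n\<close> rows is supported on a single block of
    columns, so one Frobenius exponent survives and the sum is a power of a linear form.\<close>
  have lower: "(?M * ?K) $$ (?N + i, ?N + m) = moore_translate r v ts $$ (i, m)"
    if i: "i < n" and m: "m < n" for i m
  proof -
    have i': "?N + i < r * n" and m': "?N + m < r * n" using i m rn by linarith+
    have "(?M * ?K) $$ (?N + i, ?N + m)
        = (\<Sum>c<r * n. (\<lambda>i' j. if i' = i then (constP (v j) + Xvar j) ^ (q ^ i) * constP ((ts ! m) j ^ (q ^ i)) else 0)
            (c div r) (c mod r))"
      unfolding entry[OF i' m']
      by (rule sum.cong)
        (use i m i' m' r len in \<open>auto simp: det_matrix_def hat_matrix_def Let_def nth_append translate.hom_power translate_Xvar\<close>)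
    also have "\<dots> = (\<Sum>i'<n. \<Sum>j<r. if i' = i then (constP (v j) + Xvar j) ^ (q ^ i) * constP ((ts ! m) j ^ (q ^ i)) else 0)"
      using r by (intro sum_div_mod) simp
    also have "\<dots> = (\<Sum>i'<n. if i' = i then \<Sum>j<r. (constP (v j) + Xvar j) ^ (q ^ i) * constP ((ts ! m) j ^ (q ^ i)) else 0)"
      by (rule sum.cong) auto
    also have "\<dots> = (\<Sum>j<r. (constP (v j) + Xvar j) ^ (q ^ i) * constP ((ts ! m) j ^ (q ^ i)))"
      using i by simp
    also have "\<dots> = (\<Sum>j<r. constP ((v j * (ts ! m) j) ^ (q ^ i))) + (\<Sum>j<r. Xvar j ^ (q ^ i) * constP ((ts ! m) j ^ (q ^ i)))"
      by (simp add: frobenius_add_mpoly distrib_right sum.distrib constP.hom_mult constP.hom_power power_mult_distrib)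
    also have "(\<Sum>j<r. constP ((v j * (ts ! m) j) ^ (q ^ i))) = constP (dot r v (ts ! m) ^ (q ^ i))"
      by (simp add: dot_def frobenius_sum constP.hom_sum)
    finally show ?thesis using i m by (simp add: moore_translate_def)
  qed
  have "?M * ?K = four_block_mat (1\<^sub>m ?N) (0\<^sub>m ?N n) Z (moore_translate r v ts)"
    (is "_ = ?F")
  proof (rule eq_matI)
    have dims: "dim_row ?F = r * n" "dim_col ?F = r * n"
      using rn by (simp_all add: moore_translate_def)
    then show "dim_row (?M * ?K) = dim_row ?F" "dim_col (?M * ?K) = dim_col ?F"
      using M K by auto
    fix l m assume "l < dim_row ?F" "m < dim_col ?F"
    then have lm: "l < r * n" "m < r * n" using dims by auto
    consider (ul) "l < ?N" "m < ?N" | (ur) "l < ?N" "\<not> m < ?N" | (ll) "\<not> l < ?N" "m < ?N"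
      | (lr) "\<not> l < ?N" "\<not> m < ?N" by blast
    then show "(?M * ?K) $$ (l, m) = ?F $$ (l, m)"
    proof cases
      case ul
      then show ?thesis
        using upper[OF ul(1) lm(2)] dual[of l m] len rn lm by (simp add: nth_append moore_translate_def)
    next
      case ur
      then have "m - ?N < n" using lm rn by linarith
      then show ?thesis
        using ur upper[OF ur(1) lm(2)] orth[of l "m - ?N"] len rn lm
        by (simp add: nth_append moore_translate_def)
    next
      case ll
      then have "l - ?N < n" using lm rn by linarith
      then show ?thesis
        using ll rn lm by (simp add: Z_def moore_translate_def)
    next
      case lr
      then have *: "l - ?N < n" "m - ?N < n" using lm rn by linarith+
      then have "(?M * ?K) $$ (l, m) = moore_translate r v ts $$ (l - ?N, m - ?N)"
        using lower[OF *] lr by (simp del: index_mult_mat)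
      then show ?thesis
        using lr * rn lm by (simp add: moore_translate_def del: index_mult_mat)
    qed
  qed
  then have "det (?M * ?K) = det (1\<^sub>m ?N) * det (moore_translate r v ts)"
    by (simp only:) (rule det_four_block_mat_upper_right_zero, auto simp: Z_def moore_translate_def)
  then have "det ?M * det ?K = det (moore_translate r v ts)"
    by (simp add: det_mult[OF M K])
  then show ?thesis
    by (simp add: detpoly_def translate.hom_det constP.hom_det)
qed

text \<open>On the line of all \<open>s * y\<close> each entry becomes a constant plus one monomial
  in \<open>s\<close>, the shape required by \<open>coeff_det_lowest\<close>.\<close>

lemma eval_moore_translate:
  "map_mat (subst_mpoly (\<lambda>c. [:c:]) (\<lambda>j. [:0, y j:])) (moore_translate r v ts)
    = mat n n (\<lambda>(i, m). [:dot r v (ts ! m) ^ (q ^ i):] + monom (dot r y (ts ! m) ^ (q ^ i)) (q ^ i))"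
proof (rule eq_matI)
  interpret ev: comm_ring_hom "subst_mpoly (\<lambda>c :: 'a. [:c:]) (\<lambda>j. [:0, y j:])"
    by (rule const_poly.comm_ring_hom_subst_mpoly)
  have X: "Polynomial.smult c ([:0, y j:] ^ d) = monom (y j ^ d * c) d" for j d c
  proof -
    have "[:0, y j:] ^ d = monom (y j ^ d) d"
      using monom_power[of "y j" 1 d] by (simp add: monom_altdef)
    then show ?thesis by (simp add: smult_monom mult.commute)
  qed
  fix i m assume "i < dim_row (mat n n (\<lambda>(i, m). [:dot r v (ts ! m) ^ (q ^ i):] + monom (dot r y (ts ! m) ^ (q ^ i)) (q ^ i)))"
    "m < dim_col (mat n n (\<lambda>(i, m). [:dot r v (ts ! m) ^ (q ^ i):] + monom (dot r y (ts ! m) ^ (q ^ i)) (q ^ i)))"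
  then show "map_mat (subst_mpoly (\<lambda>c. [:c:]) (\<lambda>j. [:0, y j:])) (moore_translate r v ts) $$ (i, m)
      = mat n n (\<lambda>(i, m). [:dot r v (ts ! m) ^ (q ^ i):] + monom (dot r y (ts ! m) ^ (q ^ i)) (q ^ i)) $$ (i, m)"
    by (simp add: moore_translate_def ev.hom_add ev.hom_sum ev.hom_mult ev.hom_power
        const_poly.subst_mpoly_constP const_poly.subst_mpoly_Xvar X monom_sum dot_def frobenius_sum
        power_mult_distrib)
qed (simp_all add: moore_translate_def)

end

section \<open>Multiplicity of a point\<close>

theorem mainTheorem2:
  fixes q n r k :: nat
    and U :: "(nat \<Rightarrow> 'a::{finite,field}) set"
    and bs :: "(nat \<Rightarrow> 'a) list"
    and v :: "nat \<Rightarrow> 'a"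
  assumes q_pp: "\<exists>p e. prime p \<and> e \<ge> 1 \<and> q = p ^ e"
    and n2: "n \<ge> 2" and r2: "r \<ge> 2"
    and card: "card (UNIV :: 'a set) = q ^ n"
    and U_sub: "U \<subseteq> Vspace r"
    and basis: "fq_basis q U bs"
    and dimU: "length bs = r * n - n"
    and vV: "v \<in> Vspace r" and v0: "v \<noteq> (\<lambda>_. 0)"
    and wt: "has_weight q U v k" and k2: "k \<ge> 2"
  shows "detpoly q n r bs \<noteq> 0
    \<and> multiplicity_at r v (detpoly q n r bs) = (\<Sum>i<k. q ^ i)"
proof -
  interpret fq_field q n "TYPE('a)"
    by unfold_locales (use q_pp n2 card in auto)
  have bs: "fq_indep q bs" and span_bs: "fq_span q bs = U"
    using basis by (auto simp: fq_basis_def)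
  have U: "fq_subspace U" using fq_subspace_span[of bs] by (simp add: span_bs)
  have bs_U: "set bs \<subseteq> U" using fq_span_superset[of bs] by (simp add: span_bs)
  have bs_V: "set bs \<subseteq> Vspace r" using bs_U U_sub by blast

  define T where "T = perp r U"
  define H where "H = {t \<in> T. dot r v t = 0}"
  have T: "fq_subspace T" "T \<subseteq> Vspace r" "finite T"
    using finite_subset[OF perp_subset finite_Vspace, of r U]
    by (simp_all add: T_def fq_subspace_perp perp_subset)
  \<comment> \<open>The product of the cardinalities of \<open>T\<close> and \<open>U\<close> is
    \<open>q ^ (n * r)\<close>, so \<open>T\<close> has dimension \<open>n\<close>.\<close>
  have "card T * q ^ (r * n - n) = q ^ n * q ^ (r * n - n)"
    using card_perp[OF U U_sub] card_fq_span[OF bs] r2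
    by (simp add: span_bs dimU T_def mult.commute flip: power_add)
  then have card_T: "card T = q ^ n" using q_ge_2 by simp

  \<comment> \<open>Since \<open>v\<close> is nonzero, scalars correspond to points of
    \<open>line_of v\<close>; the weight therefore counts scalars, and duality turns this into the
    size of \<open>H\<close>.\<close>
  have "card {c. smult_vec c v \<in> U} = card (line_of v \<inter> U)"
  proof (rule bij_betw_same_card)
    obtain j where j: "v j \<noteq> 0" using v0 by auto
    have "inj (\<lambda>c. smult_vec c v)"
    proof (rule injI)
      fix c d assume "smult_vec c v = smult_vec d v"
      then have "c * v j = d * v j" unfolding smult_vec_def by metis
      then show "c = d" using j by simp
    qed
    then show "bij_betw (\<lambda>c. smult_vec c v) {c. smult_vec c v \<in> U} (line_of v \<inter> U)"
      by (auto simp: bij_betw_def line_of_def intro: inj_on_subset)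
  qed
  moreover obtain ws where "length ws = k" "fq_indep q ws" "fq_span q ws = line_of v \<inter> U"
    using wt by (auto simp: has_weight_def fq_dim_def fq_basis_def)
  ultimately have "card {c. smult_vec c v \<in> U} = q ^ k"
    using card_fq_span by metis
  then have card_H: "card H = q ^ k"
    using card_perp_inter_orthogonal[OF U U_sub vV] card_T q_ge_2 by (simp add: T_def H_def)
  have H: "fq_subspace H" "H \<subseteq> T" "finite H"
    using T
    by (auto simp: H_def fq_subspace_def add_subgroup_def dot_diff_right dot_smult_right dot_zero_right
        simp del: minus_apply)
  have "q ^ k \<le> q ^ n" using card_mono[OF T(3) H(2)] by (simp add: card_H card_T)
  then have "k \<le> n" using q_ge_2 power_le_imp_le_exp[of q k n] by simp

  \<comment> \<open>A basis of \<open>T\<close> adapted to \<open>H\<close>: its first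
    \<open>k\<close> members are orthogonal to \<open>v\<close>, and no nonzero combination of the
    others is.\<close>
  obtain hs where hs: "length hs = k" "fq_indep q hs" "fq_span q hs = H"
    using fq_indep_extend[OF H(1,3) card_H fq_indep_Nil] by auto
  then have hs_H: "set hs \<subseteq> H" using fq_span_superset[of hs] by simp
  obtain cs where cs: "length (hs @ cs) = n" "fq_indep q (hs @ cs)" "fq_span q (hs @ cs) = T"
    using fq_indep_extend[OF T(1,3) card_T hs(2)] hs_H H(2) by auto
  define ts where "ts = hs @ cs"
  have ts: "length ts = n" "fq_indep q ts" "set ts \<subseteq> T"
    using cs fq_span_superset[of "hs @ cs"] by (simp_all add: ts_def)
  obtain es where es: "length es = length bs" "set es \<subseteq> Vspace r"
    and dual: "\<And>l m. l < length bs \<Longrightarrow> m < length bs \<Longrightarrow>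
          trace (dot r (bs ! l) (es ! m)) = (if l = m then 1 else 0)"
    using exists_trace_dual_family[OF bs bs_V] by metis
  have orth: "trace (dot r (bs ! l) (ts ! m)) = 0" if "l < length bs" "m < length ts" for l m
  proof -
    have "bs ! l \<in> U" "ts ! m \<in> perp r U"
      using that bs_U ts(3) by (auto simp: T_def)
    then show ?thesis by (simp add: perp_def)
  qed
  define D where "D = det (hat_matrix r (es @ ts))"
  have "D \<noteq> 0"
    unfolding D_def
  proof (rule det_hat_matrix_nonzero)
    show "fq_indep q (es @ ts)"
      by (rule fq_indep_append_dual[OF es(1) ts(2) dual orth])
    show "set (es @ ts) \<subseteq> Vspace r" using es(2) ts(3) T(2) by auto
    show "length (es @ ts) = r * n" using es(1) ts(1) dimU r2 by simp
  qed
  let ?G = "translate r v (detpoly q n r bs)" and ?M = "moore_translate r v ts"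
  have M: "?M \<in> carrier_mat n n" by (simp add: moore_translate_def)
  have G: "?G * constP D = det ?M"
    unfolding D_def
    by (rule translate_det_matrix_mult_hat_matrix) (use r2 dimU es(1) ts(1) dual orth in auto)

  have dot_v: "dot r v (ts ! m) = 0" if "m < k" for m
  proof -
    have "hs ! m \<in> H" using that hs(1) hs_H by auto
    then show ?thesis using that hs(1) by (simp add: ts_def nth_append H_def)
  qed
  have "order_ge (\<Sum>i<k. q ^ i) (det ?M)"
  proof (rule order_ge_det[OF q_ge_2 M \<open>k \<le> n\<close>])
    fix i m assume "i < n" "m < k"
    \<comment> \<open>In the first \<open>k\<close> columns the constant part is zero by
      \<open>dot_v\<close>, leaving powers of variables times constants.\<close>
    moreover have "order_ge (q ^ i + 0) (Xvar j ^ (q ^ i) * constP ((ts ! m) j ^ (q ^ i)))" for j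
      by (intro order_ge_mult order_ge_Xvar_power order_ge_0)
    ultimately show "order_ge (q ^ i) (?M $$ (i, m))"
      using \<open>k \<le> n\<close> q_ge_2
      by (auto simp: moore_translate_def dot_v power_0_left intro!: order_ge_sum)
  qed
  moreover have "?G = det ?M * constP (1 / D)"
    unfolding G[symmetric] mult.assoc constP.hom_mult[symmetric] using \<open>D \<noteq> 0\<close> by simp
  ultimately have order: "order_ge (\<Sum>i<k. q ^ i) ?G"
    using order_ge_mult[OF _ order_ge_0] by (metis add_0_right)

  \<comment> \<open>The direction in which the lowest component is tested: on \<open>H\<close> the
    form \<open>dot r y\<close> is injective, so its values at the basis \<open>hs\<close> are
    independent.\<close>
  obtain y where y: "\<And>t. t \<in> H \<Longrightarrow> t \<noteq> 0 \<Longrightarrow> dot r y t \<noteq> 0"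
  proof (rule exists_vector_not_orthogonal)
    show "H \<subseteq> Vspace r" "0 \<in> H" using H T by (auto simp: fq_subspace_def add_subgroup_def)
    show "card H \<le> q ^ n" using card_H \<open>q ^ k \<le> q ^ n\<close> by simp
  qed (use r2 in auto)
  have "det (mat k k (\<lambda>(i, m). dot r y (ts ! m) ^ (q ^ i))) \<noteq> 0"
  proof (rule moore_det_nonzero)
    fix c assume c: "\<And>j. j < k \<Longrightarrow> c j \<in> Fq q" and 0: "(\<Sum>j<k. c j * dot r y (ts ! j)) = 0"
    have "lin_comb c hs \<in> H"
      using c hs(1) by (intro fq_subspace_lin_comb[OF H(1) hs_H]) auto
    moreover have "dot r y (lin_comb c hs) = 0"
      using 0 by (simp add: dot_lin_comb hs(1) ts_def nth_append)
    ultimately have "lin_comb c hs = (\<lambda>_. 0)"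
      using y by (auto simp: zero_fun_def)
    then show "\<forall>j<k. c j = 0"
      using c hs(1) by (intro allI impI fq_indepD[OF hs(2), of c]) auto
  qed
  \<comment> \<open>The rows of this block start at exponent \<open>q ^ k\<close>, so it is the
    Moore matrix of the powers with that exponent.\<close>
  moreover have "det (mat (n - k) (n - k) (\<lambda>(i, m). dot r v (ts ! (k + m)) ^ (q ^ (k + i)))) \<noteq> 0"
  proof -
    have "det (mat (n - k) (n - k) (\<lambda>(i, m). (dot r v (ts ! (k + m)) ^ (q ^ k)) ^ (q ^ i))) \<noteq> 0"
    proof (rule moore_det_nonzero)
      fix c assume c: "\<And>j. j < n - k \<Longrightarrow> c j \<in> Fq q"
        and 0: "(\<Sum>j<n - k. c j * dot r v (ts ! (k + j)) ^ (q ^ k)) = 0"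
      have len_cs: "length cs = n - k" using cs(1) hs(1) by simp
      \<comment> \<open>Elements of \<open>Fq q\<close> are fixed by Frobenius, so the relation
        between powers is itself a power and its root can be taken.\<close>
      have "(\<Sum>j<n - k. c j * dot r v (ts ! (k + j))) ^ (q ^ k) = 0"
        using 0 c by (simp add: frobenius_sum power_mult_distrib Fq_power_q)
      then have "dot r v (lin_comb c cs) = 0"
        by (simp add: dot_lin_comb len_cs ts_def nth_append hs(1))
      moreover have "lin_comb c cs \<in> T"
        by (rule fq_subspace_lin_comb[OF T(1)]) (use c len_cs ts(3) in \<open>auto simp: ts_def\<close>)
      ultimately have "lin_comb c cs \<in> fq_span q hs" by (simp add: H_def hs(3))
      then obtain d where d: "lin_comb c cs = lin_comb d hs" "\<And>i. d i \<in> Fq q"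
        by (auto simp: fq_span_def)
      \<comment> \<open>A combination of \<open>cs\<close> orthogonal to \<open>v\<close> lies in
        \<open>H\<close>, the span of \<open>hs\<close>; moving it to one side gives a relation on
        the whole basis.\<close>
      let ?e = "\<lambda>i. if i < k then - d i else c (i - k)"
      have "lin_comb ?e hs = - lin_comb d hs"
        by (auto simp: lin_comb_def hs(1) fun_eq_iff sum_negf)
      moreover have "lin_comb (\<lambda>i. ?e (length hs + i)) cs = lin_comb c cs"
        by (rule lin_comb_cong) (simp add: hs(1))
      ultimately have "lin_comb ?e (hs @ cs) = (\<lambda>_. 0)"
        using d(1) by (simp add: lin_comb_append fun_eq_iff)
      then have "?e (k + j) = 0" if "j < n - k" for j
        using that c d(2) cs(1)
        by (intro fq_indepD[OF cs(2), of ?e]) (auto simp: Fq_uminus)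
      then show "\<forall>j<n - k. c j = 0" by simp
    qed
    then show ?thesis by (simp add: power_add power_mult)
  qed
  ultimately have lowest: "coeff (det (mat n n (\<lambda>(i, m). [:dot r v (ts ! m) ^ (q ^ i):]
      + monom (dot r y (ts ! m) ^ (q ^ i)) (q ^ i)))) (\<Sum>i<k. q ^ i) \<noteq> 0"
    using q_ge_2 by (subst coeff_det_lowest[OF q_ge_2 \<open>k \<le> n\<close>]) (auto simp: dot_v power_0_left)
  define ev where "ev = subst_mpoly (\<lambda>c :: 'a. [:c:]) (\<lambda>j. [:0, y j:])"
  interpret ev: comm_ring_hom ev
    unfolding ev_def by (rule const_poly.comm_ring_hom_subst_mpoly)
  \<comment> \<open>Evaluation commutes with the determinant, and the nonzero constant
    \<open>D\<close> only scales the coefficient.\<close>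
  have "det (mat n n (\<lambda>(i, m). [:dot r v (ts ! m) ^ (q ^ i):] + monom (dot r y (ts ! m) ^ (q ^ i)) (q ^ i)))
      = ev (det ?M)"
    unfolding eval_moore_translate[symmetric] ev_def[symmetric] by (rule ev.hom_det)
  also have "\<dots> = Polynomial.smult D (ev ?G)"
    unfolding G[symmetric] ev.hom_mult by (simp add: ev_def const_poly.subst_mpoly_constP)
  finally have "coeff (ev ?G) (\<Sum>i<k. q ^ i) \<noteq> 0"
    using lowest by auto
  with order show ?thesis unfolding ev_def by (rule multiplicity_at_eqI)
qed

end
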